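(* Let $q$ be a prime power, let $P\mathcal{U}_2\subset\mathbb{P}^3$ be a degenerate Hermitian surface of rank $3$ over $\mathbb{F}_{q^2}$ with vertex $P$, and let $V(F)$ be an $\mathbb{F}_{q^2}$-surface of degree $d\le q$ in $\mathbb{P}^3$ ($d\ge1$). Then $|(P\mathcal{U}_2\cap V(F))(\mathbb{F}_{q^2})|=1+q^2d(q+1)$ if and only if $V(F)$ is a cone with vertex at the point $P$ over a plane curve $\mathcal{C}$ defined over $\mathbb{F}_{q^2}$ such that $|(\mathcal{C}\cap P\mathcal{U}_2)(\mathbb{F}_{q^2})|=d(q+1)$.
   Context: $\mathbb{P}^3$ is projective $3$-space over $\overline{\mathbb{F}}_q$, and $X(\mathbb{F}_{q^2})$ is the set of $\mathbb{F}_{q^2}$-rational points of $X$. An $\mathbb{F}_{q^2}$-surface of degree $d$ is the zero set $V(F)$ of a nonzero homogeneous $F\in\mathbb{F}_{q^2}[x_0,\dots,x_3]$ of degree $d$ (not necessarily irreducible or reduced). A cone with vertex $P$ over a plane curve $\mathcal{C}$ is the union of all lines joining $P$ to the points of $\mathcal{C}$, where $\mathcal{C}$ is a (possibly reducible) curve lying in an $\mathbb{F}_{q^2}$-plane that does not pass through $P$. A Hermitian surface of rank $3$ in $\mathbb{P}^3$ is the zero set of $\sum_{i,j}h_{ij}x_ix_j^q$ for a $4\times4$ matrix $H=(h_{ij})$ over $\mathbb{F}_{q^2}$ of rank $3$ with $h_{ij}=h_{ji}^q$. Up to an $\mathbb{F}_{q^2}$-linear change of coordinates it is $V(x_0^{q+1}+x_1^{q+1}+x_2^{q+1})$,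 a cone with vertex an $\mathbb{F}_{q^2}$-point $P$ (here $P=[0:0:0:1]$) over a non-degenerate Hermitian curve $\mathcal{U}_2$ of a plane not through $P$; it is denoted $P\mathcal{U}_2$. *)

theory Defs
  imports
    "HOL-Analysis.Analysis"
    "HOL-Library.Poly_Mapping"
    "HOL-Number_Theory.Prime_Powers"
    "HOL-Algebra.Algebraic_Closure_Type"
begin

unbundle no fps_syntax

text \<open>
  The finite field with \<open>q\<^sup>2\<close> elements is a type \<open>'k\<close> of classes \<open>field\<close> and \<open>finite\<close> with
  \<open>CARD('k) = q\<^sup>2\<close>; its algebraic closure, which is also that of the field with \<open>q\<close> elements,
  is \<open>'k alg_closure\<close>, with embedding \<open>to_ac\<close>.  A projective point over the closure is the
  one-dimensional subspace of vectors representing it, so \<open>'n\<close> is the type of homogeneous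
  coordinates and the projective space has dimension \<open>CARD('n) - 1\<close>.
\<close>

type_synonym ('k, 'n) ppoint = "('k alg_closure ^ 'n) set"

definition proj_point :: "'k::field alg_closure ^ 'n::finite \<Rightarrow> ('k, 'n) ppoint" where
  "proj_point v = vec.span {v}"

definition proj_space :: "('k::field, 'n::finite) ppoint set" where
  "proj_space = {proj_point v | v. v \<noteq> 0}"

definition rational_points :: "('k::field, 'n::finite) ppoint set \<Rightarrow> ('k, 'n) ppoint set" where
  "rational_points S = {p \<in> S. \<exists>v :: 'k ^ 'n. v \<noteq> 0 \<and> p = proj_point (\<chi> i. to_ac (v $ i))}"

text \<open>
  A polynomial in variables indexed by \<open>'n\<close> is a finitely supported map from exponent vectors
  to coefficients.
\<close>

type_synonym ('k, 'n) mvpoly = "('n \<Rightarrow>\<^sub>0 nat) \<Rightarrow>\<^sub>0 'k"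

definition mvpoly_eval :: "('k::field, 'n::finite) mvpoly \<Rightarrow> 'k alg_closure ^ 'n \<Rightarrow> 'k alg_closure" where
  "mvpoly_eval F v =
     (\<Sum>m \<in> Poly_Mapping.keys F. to_ac (Poly_Mapping.lookup F m) *
        (\<Prod>i \<in> UNIV. (v $ i) ^ Poly_Mapping.lookup m i))"

definition homogeneous :: "nat \<Rightarrow> ('k::field, 'n::finite) mvpoly \<Rightarrow> bool" where
  "homogeneous d F \<longleftrightarrow>
     (\<forall>m \<in> Poly_Mapping.keys F. (\<Sum>i \<in> UNIV. Poly_Mapping.lookup m i) = d)"

definition zero_locus :: "('k::field, 'n::finite) mvpoly \<Rightarrow> ('k, 'n) ppoint set" where
  "zero_locus F = {proj_point v | v. v \<noteq> 0 \<and> mvpoly_eval F v = 0}"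

text \<open>
  A \<open>'k\<close>-rational plane of projective 3-space is given by a \<open>4 \<times> 3\<close> matrix over \<open>'k\<close> of rank 3,
  whose columns are the points of a coordinate frame: \<open>frame_map M\<close> identifies the projective plane
  with the plane spanned by the columns of \<open>M\<close>.
\<close>

definition frame_map :: "'k::field ^ 3 ^ 4 \<Rightarrow> ('k, 3) ppoint \<Rightarrow> ('k, 4) ppoint" where
  "frame_map M p = (*v) (map_matrix to_ac M) ` p"

definition plane_of :: "'k::field ^ 3 ^ 4 \<Rightarrow> ('k, 4) ppoint set" where
  "plane_of M = frame_map M ` proj_space"

text \<open>Curves, like surfaces, may be reducible or non-reduced; the degree \<open>e\<close> is positive.\<close>

definition plane_curve :: "'k::field ^ 3 ^ 4 \<Rightarrow> ('k, 4) ppoint set \<Rightarrow> bool" where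
  "plane_curve M C \<longleftrightarrow>
     (\<exists>e (G :: ('k, 3) mvpoly). e \<ge> 1 \<and> G \<noteq> 0 \<and> homogeneous e G \<and> C = frame_map M ` zero_locus G)"

definition line_through :: "('k::field, 'n::finite) ppoint \<Rightarrow> ('k, 'n) ppoint \<Rightarrow> ('k, 'n) ppoint set" where
  "line_through P Q = {R \<in> proj_space. R \<subseteq> vec.span (P \<union> Q)}"

definition proj_cone :: "('k::field, 'n::finite) ppoint \<Rightarrow> ('k, 'n) ppoint set \<Rightarrow> ('k, 'n) ppoint set" where
  "proj_cone P C = (\<Union>Q \<in> C. line_through P Q)"

definition hermitian_matrix :: "nat \<Rightarrow> 'k::field ^ 'n ^ 'n::finite \<Rightarrow> bool" where
  "hermitian_matrix q H \<longleftrightarrow> (\<forall>i j. H $ i $ j = (H $ j $ i) ^ q)"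

definition hermitian_variety :: "nat \<Rightarrow> 'k::field ^ 'n ^ 'n::finite \<Rightarrow> ('k, 'n) ppoint set" where
  "hermitian_variety q H =
     {proj_point v | v. v \<noteq> 0 \<and> (\<Sum>i \<in> UNIV. \<Sum>j \<in> UNIV. to_ac (H $ i $ j) * v $ i * (v $ j) ^ q) = 0}"

definition nondegenerate_hermitian_curve :: "nat \<Rightarrow> 'k::field ^ 3 ^ 4 \<Rightarrow> ('k, 4) ppoint set \<Rightarrow> bool" where
  "nondegenerate_hermitian_curve q M U \<longleftrightarrow>
     (\<exists>H :: 'k ^ 3 ^ 3. hermitian_matrix q H \<and> rank H = 3 \<and> U = frame_map M ` hermitian_variety q H)"

text \<open>
  \<open>S\<close> is a Hermitian surface of rank 3; the second and third conjuncts say that \<open>P\<close> is its vertex.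
\<close>

definition rank3_hermitian_surface :: "nat \<Rightarrow> ('k::field, 4) ppoint \<Rightarrow> ('k, 4) ppoint set \<Rightarrow> bool" where
  "rank3_hermitian_surface q P S \<longleftrightarrow>
     (\<exists>H :: 'k ^ 4 ^ 4. hermitian_matrix q H \<and> rank H = 3 \<and> S = hermitian_variety q H) \<and>
     P \<in> rational_points proj_space \<and>
     (\<exists>M U. rank M = 3 \<and> P \<notin> plane_of M \<and> nondegenerate_hermitian_curve q M U \<and> S = proj_cone P U)"

end

theory Submission
  imports Defs "HOL-Number_Theory.Residues"
begin

unbundle no fps_syntax

text \<open>
  Choose coordinates with \<open>P = [0:0:0:1]\<close> and let \<open>e\<close> be the largest exponent of the last variable \<open>t\<close> in
  \<open>F\<close>. If \<open>e = 0\<close>, then \<open>V(F)\<close> is a cone, and counting along the lines through \<open>P\<close> shows that the surfaces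
  meet in \<open>1 + q\<^sup>2 N\<close> rational points, where \<open>N\<close> counts the common points of the base curve and the
  Hermitian cone. If \<open>e > 0\<close>, let \<open>g\<close>, of degree \<open>d - e < q\<close>, be the coefficient of \<open>t ^ e\<close>. Each of the at
  most \<open>q ^ 3 + 1\<close> rational lines of the Hermitian cone carries at most \<open>e\<close> further points of \<open>F\<close>,
  unless \<open>g\<close> vanishes on it, which by Bezout's theorem happens for at
  most \<open>(d - e)(q + 1)\<close> lines; these carry at most \<open>q\<^sup>2\<close> points each. The total stays below
  \<open>1 + q\<^sup>2 d (q + 1)\<close>.

  This case of Bezout's theorem is the footprint bound of Hermitian codes: on the affine curve
  \<open>y ^ q + y + a * x ^ (q + 1) + \<dots> = 0\<close> a polynomial has at most as many zeros as its pole order at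
  infinity, where \<open>x\<close> and \<open>y\<close> have pole orders \<open>q\<close> and \<open>q + 1\<close>. Numbers of points are obtained from numbers of nonzero
  vectors, which are \<open>q\<^sup>2 - 1\<close> times as large.
\<close>

section \<open>Zeros on the affine Hermitian curve\<close>

text \<open>
  With weight \<open>q * i + (q + 1) * j\<close> for \<open>x ^ i * y ^ j\<close>, the curve equation trades \<open>y ^ q\<close> for
  \<open>- a * x ^ (q + 1)\<close>, of the same weight, up to terms of smaller weight. Together with the multiples of the
  polynomial vanishing on \<open>Z\<close> this reduces every monomial to those in \<open>base\<close>, whose number is the
  weight of the leading monomial.
\<close>

lemma footprint_functional_eq_0:
  fixes \<phi> :: "'a::field \<times> 'a \<Rightarrow> 'a" and k l :: "'s \<Rightarrow> nat"
  assumes q: "q \<ge> 2" and a: "a \<noteq> 0"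
    and curve: "\<And>x y. (x, y) \<in> Z \<Longrightarrow> y ^ q + y + a * x ^ (q + 1) + b * x ^ q + b' * x + c = 0"
    and zero: "\<And>x y. (x, y) \<in> Z \<Longrightarrow> (\<Sum>s\<in>I. \<alpha> s * (x ^ k s * y ^ l s)) = 0"
    and I: "finite I" "s0 \<in> I" "\<alpha> s0 \<noteq> 0"
    and lq: "\<And>s. s \<in> I \<Longrightarrow> l s < q"
    and lead: "\<And>s. s \<in> I \<Longrightarrow> s \<noteq> s0 \<Longrightarrow> q * k s + (q + 1) * l s < q * k s0 + (q + 1) * l s0"
    and base: "\<And>i j. j < q \<Longrightarrow> i < k s0 + (if j < l s0 then q + 1 else 0) \<Longrightarrow>
                 (\<Sum>(x, y)\<in>Z. \<phi> (x, y) * (x ^ i * y ^ j)) = 0"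
  shows "(\<Sum>(x, y)\<in>Z. \<phi> (x, y) * (x ^ i * y ^ j)) = 0"
proof -
  define \<Lambda> where "\<Lambda> i j = (\<Sum>(x, y)\<in>Z. \<phi> (x, y) * (x ^ i * y ^ j))" for i j
  have rel1: "\<Lambda> i (j + q) + \<Lambda> i (j + 1) + a * \<Lambda> (i + (q + 1)) j + b * \<Lambda> (i + q) j + b' * \<Lambda> (i + 1) j
      + c * \<Lambda> i j = 0" for i j
  proof -
    have "\<Lambda> i (j + q) + \<Lambda> i (j + 1) + a * \<Lambda> (i + (q + 1)) j + b * \<Lambda> (i + q) j + b' * \<Lambda> (i + 1) j
      + c * \<Lambda> i j = (\<Sum>(x, y)\<in>Z. \<phi> (x, y) * (x ^ i * y ^ j) *
          (y ^ q + y + a * x ^ (q + 1) + b * x ^ q + b' * x + c))"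
      unfolding \<Lambda>_def sum_distrib_left sum.distrib[symmetric] case_prod_unfold
      by (intro sum.cong refl) (simp add: power_add algebra_simps)
    also have "\<dots> = 0"
      by (intro sum.neutral) (auto dest: curve)
    finally show ?thesis .
  qed
  have rel2: "(\<Sum>s\<in>I. \<alpha> s * \<Lambda> (k s + i) (l s + j)) = 0" for i j
  proof -
    have "(\<Sum>s\<in>I. \<alpha> s * \<Lambda> (k s + i) (l s + j)) =
        (\<Sum>(x, y)\<in>Z. \<phi> (x, y) * (x ^ i * y ^ j) * (\<Sum>s\<in>I. \<alpha> s * (x ^ k s * y ^ l s)))"
      unfolding \<Lambda>_def sum_distrib_left case_prod_unfold
      by (subst sum.swap) (intro sum.cong refl, simp add: power_add algebra_simps)
    also have "\<dots> = 0"
      by (intro sum.neutral ballI) (simp add: zero case_prod_unfold)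
    finally show ?thesis .
  qed
  have lead_eq: "\<Lambda> (k s0 + i) (l s0 + j) = 0"
    if "\<And>s. s \<in> I \<Longrightarrow> s \<noteq> s0 \<Longrightarrow> \<Lambda> (k s + i) (l s + j) = 0" for i j
  proof -
    have "(\<Sum>s\<in>I. \<alpha> s * \<Lambda> (k s + i) (l s + j)) = \<alpha> s0 * \<Lambda> (k s0 + i) (l s0 + j)"
      using I by (subst sum.remove[of _ s0]) (auto simp: that)
    then show ?thesis
      using rel2[of i j] I by simp
  qed
  have "\<Lambda> i j = 0" if "q * i + (q + 1) * j = n" for n i j
    using that
  proof (induction n arbitrary: i j rule: less_induct)
    case (less n)
    have IH: "\<Lambda> i' j' = 0" if "q * i' + (q + 1) * j' < n" for i' j'
      using less.IH that by blast
    have std: "\<Lambda> i j = 0" if ij: "j < q" "q * i + (q + 1) * j = n" for i j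
    proof (cases "i < k s0 + (if j < l s0 then q + 1 else 0)")
      case True
      then show ?thesis using base ij unfolding \<Lambda>_def by blast
    next
      case ge: False
      show ?thesis
      proof (cases "j < l s0")
        case False
        \<comment> \<open>The leading monomial divides \<open>x ^ i * y ^ j\<close>; the other terms
          of this multiple weigh less than \<open>n\<close>.\<close>
        define i' j' where "i' = i - k s0" and "j' = j - l s0"
        have ij': "i = k s0 + i'" "j = l s0 + j'"
          using ge False by (auto simp: i'_def j'_def)
        have "\<Lambda> (k s + i') (l s + j') = 0" if "s \<in> I" "s \<noteq> s0" for s
          by (rule IH) (use lead[OF that] ij ij' in \<open>simp add: algebra_simps\<close>)
        then show ?thesis
          unfolding ij' by (rule lead_eq)
      next
        case True
        \<comment> \<open>The leading monomial does not divide \<open>x ^ i * y ^ j\<close>, but the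
          exponent of \<open>x\<close> is large enough to trade \<open>x ^ (q + 1)\<close> for
          \<open>y ^ q\<close>. The result has the same weight and is divisible.\<close>
        define i' j' where "i' = i - k s0 - (q + 1)" and "j' = j + q - l s0"
        have l0: "l s0 < q" using lq I by blast
        have ij': "i = k s0 + i' + (q + 1)" "j + q = l s0 + j'"
          using ge True l0 by (auto simp: i'_def j'_def)
        have n: "n = q * (k s0 + i') + (q + 1) * (l s0 + j')"
          unfolding ij(2)[symmetric] ij'(2)[symmetric] unfolding ij'(1) by (simp add: algebra_simps)
        have "\<Lambda> (k s + i') (l s + j') = 0" if "s \<in> I" "s \<noteq> s0" for s
          by (rule IH) (use lead[OF that] n in \<open>simp add: algebra_simps\<close>)
        then have "\<Lambda> (k s0 + i') (l s0 + j') = 0"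
          by (rule lead_eq)
        then have top: "\<Lambda> (k s0 + i') (j + q) = 0"
          by (simp add: ij'(2))
        have n2: "n = q * (k s0 + i') + (q + 1) * (j + q)"
          using n ij' by simp
        have "q < q * q" "1 < q * q" using q less_1_mult[of q q] by auto
        then have "\<Lambda> (k s0 + i') (j + 1) = 0" "\<Lambda> (k s0 + i' + q) j = 0" "\<Lambda> (k s0 + i' + 1) j = 0" "\<Lambda> (k s0 + i') j = 0"
          using q by (auto intro!: IH simp: n2 algebra_simps)
        then have "a * \<Lambda> (k s0 + i' + (q + 1)) j = 0"
          using rel1[of "k s0 + i'" j] top by simp
        then show ?thesis
          using a unfolding ij'(1) by simp
      qed
    qed
    \<comment> \<open>For \<open>j\<close> at least \<open>q\<close> the curve relation lowers
      \<open>j\<close> at constant weight, so a second induction, on \<open>j\<close>, reduces to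
      \<open>std\<close>.\<close>
    show ?case
      using less.prems
    proof (induction j arbitrary: i rule: less_induct)
      case (less j)
      show ?case
      proof (cases "j < q")
        case True
        then show ?thesis using std less.prems by blast
      next
        case False
        define j' where "j' = j - q"
        have j: "j = j' + q" using False by (simp add: j'_def)
        have n2: "n = q * i + (q + 1) * (j' + q)"
          using less.prems j by simp
        have "q < q * q" "1 < q * q" using q less_1_mult[of q q] by auto
        then have "\<Lambda> i (j' + 1) = 0" "\<Lambda> (i + q) j' = 0" "\<Lambda> (i + 1) j' = 0" "\<Lambda> i j' = 0"
          using q by (auto intro!: IH simp: n2 algebra_simps)
        moreover have "\<Lambda> (i + (q + 1)) j' = 0"
          by (rule less.IH) (use j q n2 in \<open>auto simp: algebra_simps\<close>)
        ultimately show ?thesis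
          using rel1[of i j'] unfolding j by simp
      qed
    qed
  qed
  then show ?thesis
    unfolding \<Lambda>_def by blast
qed

lemma sum_poly_mult_poly_eq_0:
  fixes \<phi> :: "'a::field \<times> 'a \<Rightarrow> 'a"
  assumes "\<And>i j. (\<Sum>(x, y)\<in>Z. \<phi> (x, y) * (x ^ i * y ^ j)) = 0"
  shows "(\<Sum>(x, y)\<in>Z. \<phi> (x, y) * (poly f x * poly g y)) = 0"
proof -
  have "poly f x * poly g y = (\<Sum>i\<le>Polynomial.degree f. \<Sum>j\<le>Polynomial.degree g.
      Polynomial.coeff f i * (Polynomial.coeff g j * (x ^ i * y ^ j)))" for x y
    unfolding poly_altdef sum_product by (intro sum.cong refl) (simp add: algebra_simps)
  then have "(\<Sum>(x, y)\<in>Z. \<phi> (x, y) * (poly f x * poly g y)) =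
      (\<Sum>z\<in>Z. \<Sum>i\<le>Polynomial.degree f. \<Sum>j\<le>Polynomial.degree g.
        Polynomial.coeff f i * (Polynomial.coeff g j * (\<phi> z * (fst z ^ i * snd z ^ j))))"
    by (simp add: case_prod_unfold sum_distrib_left algebra_simps)
  also have "\<dots> = (\<Sum>i\<le>Polynomial.degree f. \<Sum>j\<le>Polynomial.degree g. Polynomial.coeff f i * (Polynomial.coeff g j *
      (\<Sum>(x, y)\<in>Z. \<phi> (x, y) * (x ^ i * y ^ j))))"
    unfolding sum_distrib_left case_prod_unfold
    by (subst sum.swap, intro sum.cong refl, subst sum.swap) simp
  also have "\<dots> = 0"
    by (simp add: assms)
  finally show ?thesis .
qed

lemma ex_poly_separating_point:
  assumes "finite S" "x0 \<notin> S"
  shows "\<exists>f::'a::field poly. poly f x0 \<noteq> 0 \<and> (\<forall>x\<in>S. poly f x = 0)"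
  by (rule exI[of _ "\<Prod>x\<in>S. [:- x, 1:]"]) (use assms in \<open>auto simp: poly_prod\<close>)

text \<open>The functional is applied to a product of a polynomial in \<open>x\<close> and one in
  \<open>y\<close> that is nonzero at \<open>z\<close> and vanishes on the rest of
  \<open>Z\<close>.\<close>

lemma functional_eq_0I:
  fixes \<phi> :: "'a::field \<times> 'a \<Rightarrow> 'a"
  assumes "\<And>i j. (\<Sum>(x, y)\<in>Z. \<phi> (x, y) * (x ^ i * y ^ j)) = 0" and Z: "finite Z" "z \<in> Z"
  shows "\<phi> z = 0"
proof -
  obtain f where f: "poly f (fst z) \<noteq> 0" "\<And>x. x \<in> fst ` Z - {fst z} \<Longrightarrow> poly f x = 0"
    using ex_poly_separating_point[of "fst ` Z - {fst z}" "fst z"] Z by auto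
  obtain g where g: "poly g (snd z) \<noteq> 0" "\<And>x. x \<in> snd ` Z - {snd z} \<Longrightarrow> poly g x = 0"
    using ex_poly_separating_point[of "snd ` Z - {snd z}" "snd z"] Z by auto
  have vanish: "poly f (fst z') * poly g (snd z') = 0" if "z' \<in> Z - {z}" for z'
  proof -
    have "fst z' \<noteq> fst z \<or> snd z' \<noteq> snd z" using that by (auto simp: prod_eq_iff)
    then show ?thesis using f(2)[of "fst z'"] g(2)[of "snd z'"] that by auto
  qed
  have "0 = (\<Sum>z'\<in>Z. \<phi> z' * (poly f (fst z') * poly g (snd z')))"
    using sum_poly_mult_poly_eq_0[OF assms(1), of f g] by (simp add: case_prod_unfold)
  also have "\<dots> = \<phi> z * (poly f (fst z) * poly g (snd z))"
    using vanish Z by (subst sum.remove[of _ z]) (simp_all add: sum.neutral)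
  finally show ?thesis
    using f(1) g(1) by simp
qed

text \<open>A homogeneous system with more unknowns than equations has a nonzero solution. Over a
  finite field the pigeonhole principle suffices: two assignments with equal values on all equations
  are subtracted.\<close>

lemma ex_nonzero_functional:
  fixes e :: "'b \<Rightarrow> 'z \<Rightarrow> 'a::{field,finite}"
  assumes "finite Z" "finite B" "card B < card Z"
  shows "\<exists>\<phi>. (\<exists>z\<in>Z. \<phi> z \<noteq> 0) \<and> (\<forall>b\<in>B. (\<Sum>z\<in>Z. \<phi> z * e b z) = 0)"
proof -
  define \<Psi> where "\<Psi> \<phi> = (\<lambda>b\<in>B. \<Sum>z\<in>Z. \<phi> z * e b z)" for \<phi>
  let ?D = "Z \<rightarrow>\<^sub>E (UNIV :: 'a set)" and ?C = "B \<rightarrow>\<^sub>E (UNIV :: 'a set)"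
  have fin: "finite ?D" "finite ?C" using assms by (auto intro!: finite_PiE)
  have "card {0::'a, 1} \<le> CARD('a)"
    by (intro card_mono) auto
  then have "CARD('a) > 1" by simp
  then have "card ?C < card ?D"
    using assms by (simp add: card_PiE)
  moreover have "\<Psi> ` ?D \<subseteq> ?C"
    by (auto simp: \<Psi>_def)
  ultimately have "\<not> inj_on \<Psi> ?D"
    using fin card_inj_on_le[of \<Psi> ?D ?C] by linarith
  then obtain f g where fg: "f \<in> ?D" "g \<in> ?D" "\<Psi> f = \<Psi> g" "f \<noteq> g"
    by (auto simp: inj_on_def)
  have "\<exists>z\<in>Z. f z \<noteq> g z"
    using fg by (metis PiE_ext)
  moreover have "(\<Sum>z\<in>Z. (f z - g z) * e b z) = 0" if "b \<in> B" for b
    using fun_cong[OF fg(3), of b] that by (simp add: \<Psi>_def left_diff_distrib sum_subtractf)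
  ultimately show ?thesis
    by (intro exI[of _ "\<lambda>z. f z - g z"]) auto
qed

text \<open>With more points in \<open>Z\<close> than base monomials, some nonzero functional on
  \<open>Z\<close> would kill the base, hence every monomial, and so be zero.\<close>

lemma footprint_bound:
  fixes a :: "'a::{field,finite}" and k l :: "'s \<Rightarrow> nat"
  assumes q: "q \<ge> 2" and a: "a \<noteq> 0"
    and curve: "\<And>x y. (x, y) \<in> Z \<Longrightarrow> y ^ q + y + a * x ^ (q + 1) + b * x ^ q + b' * x + c = 0"
    and zero: "\<And>x y. (x, y) \<in> Z \<Longrightarrow> (\<Sum>s\<in>I. \<alpha> s * (x ^ k s * y ^ l s)) = 0"
    and I: "finite I" "s0 \<in> I" "\<alpha> s0 \<noteq> 0"
    and lq: "\<And>s. s \<in> I \<Longrightarrow> l s < q"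
    and lead: "\<And>s. s \<in> I \<Longrightarrow> s \<noteq> s0 \<Longrightarrow> q * k s + (q + 1) * l s < q * k s0 + (q + 1) * l s0"
  shows "card Z \<le> q * k s0 + (q + 1) * l s0"
proof (rule ccontr)
  assume contra: "\<not> ?thesis"
  \<comment> \<open>Each of the \<open>q\<close> values of \<open>j\<close> admits
    \<open>k s0\<close> exponents of \<open>x\<close>, and the \<open>l s0\<close> smallest ones
    admit \<open>q + 1\<close> more: in total the weight of the leading monomial.\<close>
  define B where "B = (SIGMA j:{..<q}. {..<k s0 + (if j < l s0 then q + 1 else 0)})"
  have l0: "l s0 < q" using lq I by blast
  have "card B = (\<Sum>j<q. k s0 + (if j < l s0 then q + 1 else 0))"
    by (simp add: B_def)
  also have "\<dots> = q * k s0 + (\<Sum>j\<in>{..<q} \<inter> {j. j < l s0}. q + 1)"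
    using sum.inter_restrict[of "{..<q}" "\<lambda>_. q + 1" "{j. j < l s0}"]
    by (simp only: sum.distrib mem_Collect_eq finite_lessThan) simp
  also have "{..<q} \<inter> {j. j < l s0} = {..<l s0}"
    using l0 by auto
  finally have "card B < card Z"
    using contra by (simp add: mult.commute)
  moreover have "finite Z" by simp
  moreover have "finite B" by (simp add: B_def)
  ultimately obtain \<phi> where \<phi>: "\<exists>z\<in>Z. \<phi> z \<noteq> 0"
      "\<forall>(j, i)\<in>B. (\<Sum>(x, y)\<in>Z. \<phi> (x, y) * (x ^ i * y ^ j)) = 0"
    using ex_nonzero_functional[of Z B "\<lambda>(j, i) (x, y). x ^ i * y ^ j"]
    by (auto simp: case_prod_unfold)
  have "(\<Sum>(x, y)\<in>Z. \<phi> (x, y) * (x ^ i * y ^ j)) = 0" for i j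
    by (rule footprint_functional_eq_0[OF q a curve zero I lq lead])
      (use \<phi>(2) in \<open>auto simp: B_def\<close>)
  then show False
    using functional_eq_0I[of \<phi> Z] \<phi>(1) by auto
qed

section \<open>Points of a Hermitian cone on a surface\<close>

text \<open>A solution with \<open>z\<close> nonzero is a multiple of one with \<open>z = 1\<close>.
  At infinity \<open>x = 0\<close>, so only the multiples of \<open>(0, 1, 0)\<close>
  remain.\<close>

lemma card_projective_solutions_le:
  fixes \<Phi> :: "'a::{field,finite} \<Rightarrow> 'a \<Rightarrow> 'a \<Rightarrow> bool"
  assumes scale: "\<And>c x y z. c \<noteq> 0 \<Longrightarrow> \<Phi> x y z \<Longrightarrow> \<Phi> (c * x) (c * y) (c * z)"
    and inf: "\<And>x y. \<Phi> x y 0 \<Longrightarrow> x = 0"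
  shows "card {(x, y, z). (x, y, z) \<noteq> (0, 0, 0) \<and> \<Phi> x y z}
    \<le> (CARD('a) - 1) * (card {(x, y). \<Phi> x y 1} + (if \<Phi> 0 1 0 then 1 else 0))"
proof -
  let ?K = "UNIV - {0 :: 'a}" and ?A = "{(x, y). \<Phi> x y 1}"
  let ?B = "if \<Phi> 0 1 0 then ?K else {}"
  let ?f = "\<lambda>(c, x, y). (c * x, c * y, c)" and ?g = "\<lambda>c::'a. (0::'a, c, 0::'a)"
  have "(x, y, z) \<in> ?f ` (?K \<times> ?A) \<union> ?g ` ?B" if "(x, y, z) \<noteq> (0, 0, 0)" "\<Phi> x y z" for x y z
  proof (cases "z = 0")
    case True
    then have "x = 0" "y \<noteq> 0" using inf that by auto
    moreover have "\<Phi> 0 1 0"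
      using scale[of "1 / y" x y z] that True \<open>x = 0\<close> \<open>y \<noteq> 0\<close> by simp
    ultimately show ?thesis using True by auto
  next
    case False
    then have "\<Phi> (x / z) (y / z) 1"
      using scale[of "1 / z" x y z] that by simp
    then have "(z, x / z, y / z) \<in> ?K \<times> ?A" using False by simp
    moreover have "(x, y, z) = ?f (z, x / z, y / z)" using False by simp
    ultimately show ?thesis by (intro UnI1 image_eqI)
  qed
  then have "{(x, y, z). (x, y, z) \<noteq> (0, 0, 0) \<and> \<Phi> x y z} \<subseteq> ?f ` (?K \<times> ?A) \<union> ?g ` ?B"
    by blast
  then have "card {(x, y, z). (x, y, z) \<noteq> (0, 0, 0) \<and> \<Phi> x y z} \<le> card (?f ` (?K \<times> ?A) \<union> ?g ` ?B)"
    by (intro card_mono) auto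
  also have "\<dots> \<le> card (?f ` (?K \<times> ?A)) + card (?g ` ?B)"
    by (rule card_Un_le)
  also have "\<dots> \<le> card (?K \<times> ?A) + card ?B"
    by (intro add_mono card_image_le) auto
  also have "\<dots> = (CARD('a) - 1) * (card ?A + (if \<Phi> 0 1 0 then 1 else 0))"
    by (simp add: card_cartesian_product card_Diff_singleton algebra_simps)
  finally show ?thesis .
qed

text \<open>Several indices may share an exponent, so the coefficient of \<open>t ^ e\<close> is a
  sum. If it is nonzero, the polynomial is nonzero of degree at most \<open>e\<close>.\<close>

lemma card_roots_le:
  fixes \<alpha> :: "'s \<Rightarrow> 'a::field"
  assumes "finite I" "\<And>s. s \<in> I \<Longrightarrow> n s \<le> e" "(\<Sum>s\<in>{s\<in>I. n s = e}. \<alpha> s) \<noteq> 0"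
  shows "card {t. (\<Sum>s\<in>I. \<alpha> s * t ^ n s) = 0} \<le> e"
proof -
  define p where "p = (\<Sum>s\<in>I. Polynomial.monom (\<alpha> s) (n s))"
  have "Polynomial.coeff p e = (\<Sum>s\<in>I. if n s = e then \<alpha> s else 0)"
    unfolding p_def coeff_sum by (intro sum.cong refl) auto
  also have "\<dots> = (\<Sum>s\<in>{s\<in>I. n s = e}. \<alpha> s)"
    using assms(1) by (simp add: sum.inter_filter)
  finally have "p \<noteq> 0" using assms(3) by auto
  then have "card {t. poly p t = 0} \<le> Polynomial.degree p"
    by (rule card_poly_roots_bound)
  also have "Polynomial.degree p \<le> e"
    unfolding p_def using assms(1,2)
    by (intro degree_sum_le) (auto intro: order_trans[OF degree_monom_le])
  finally show ?thesis
    by (simp add: p_def poly_sum poly_monom)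
qed

text \<open>For each of the \<open>q\<^sup>2\<close> values of \<open>x\<close> there remains a
  monic equation of degree \<open>q\<close> in \<open>y\<close>.\<close>

lemma card_hermitian_affine_le:
  fixes g :: "'a::{field,finite} \<Rightarrow> 'a"
  assumes q: "q \<ge> 2" and "CARD('a) = q\<^sup>2"
  shows "card {(x, y :: 'a). y ^ q + y + g x = 0} \<le> q ^ 3"
proof -
  have "card {y :: 'a. y ^ q + y + c = 0} \<le> q" for c
  proof -
    have "{s \<in> {0, 1, q}. id s = q} = {q}" using q by auto
    then have "(\<Sum>s\<in>{s \<in> {0, 1, q}. id s = q}. if s = 0 then c else 1) \<noteq> 0"
      using q by (simp only: sum.insert finite.emptyI) simp
    with q have "card {t. (\<Sum>s\<in>{0, 1, q}. (if s = 0 then c else 1) * t ^ id s) = 0} \<le> q"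
      by (intro card_roots_le) auto
    then show ?thesis using q by (simp add: add_ac)
  qed
  then have "(\<Sum>x\<in>UNIV. card {y :: 'a. y ^ q + y + g x = 0}) \<le> (\<Sum>x\<in>(UNIV :: 'a set). q)"
    by (intro sum_mono)
  moreover have "{(x, y :: 'a). y ^ q + y + g x = 0} = (SIGMA x:UNIV. {y. y ^ q + y + g x = 0})"
    by auto
  ultimately show ?thesis
    using assms by (simp add: power3_eq_cube power2_eq_square)
qed

text \<open>
  The plane curve is taken in coordinates in which \<open>(0, 1, 0)\<close> is its only point on the line \<open>z = 0\<close>;
  the second summand counts that point. The monomial \<open>y ^ r\<close> is the only one of weight \<open>r * (q + 1)\<close>,
  and it occurs exactly when the form does not vanish at \<open>(0, 1, 0)\<close>.
\<close>

lemma card_hermitian_curve_inter_le: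
  fixes a b b' c :: "'a::{field,finite}" and q :: nat and k l m :: "'s \<Rightarrow> nat"
  defines "h \<equiv> \<lambda>x y. y ^ q + y + a * x ^ (q + 1) + b * x ^ q + b' * x + c"
  assumes q: "q \<ge> 2" and a: "a \<noteq> 0"
    and I: "finite I" "I \<noteq> {}" "\<And>s. s \<in> I \<Longrightarrow> \<alpha> s \<noteq> 0"
    and r: "\<And>s. s \<in> I \<Longrightarrow> k s + l s + m s = r" "r < q"
    and inj: "inj_on (\<lambda>s. (k s, l s, m s)) I"
  shows "card {(x, y). h x y = 0 \<and> (\<Sum>s\<in>I. \<alpha> s * (x ^ k s * y ^ l s)) = 0} +
     (if (\<Sum>s\<in>I. \<alpha> s * (0 ^ k s * 1 ^ l s * 0 ^ m s)) = 0 then 1 else 0) \<le> r * (q + 1)"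
proof -
  define w where "w s = q * k s + (q + 1) * l s" for s
  have lq: "l s < q" if "s \<in> I" for s
    using r(1)[OF that] r(2) by linarith
  \<comment> \<open>Since \<open>l s < q\<close>, division of the weight by \<open>q\<close>
    recovers \<open>l s\<close> and \<open>k s + l s\<close>; the degree then gives
    \<open>m s\<close>. So the largest weight occurs only once.\<close>
  have w_inj: "s = s'" if "s \<in> I" "s' \<in> I" "w s = w s'" for s s'
  proof -
    have "w s = l s + q * (k s + l s)" for s
      by (simp add: w_def algebra_simps)
    then have "l s = w s mod q" "k s + l s = w s div q" if "s \<in> I" for s
      using lq[OF that] q by simp_all
    then have "l s = l s'" "k s + l s = k s' + l s'" using that by metis+
    moreover from this r(1)[of s] r(1)[of s'] that have "m s = m s'" by linarith
    ultimately show ?thesis using inj that by (auto simp: inj_on_def)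
  qed
  obtain s0 where s0: "s0 \<in> I" "\<And>s. s \<in> I \<Longrightarrow> w s \<le> w s0"
    using I Max_in[of "w ` I"] Max_ge[of "w ` I"] by (metis (no_types, lifting) finite_imageI image_iff image_is_empty imageI)
  have "w s < w s0" if "s \<in> I" "s \<noteq> s0" for s
    using s0 w_inj that by (metis order_le_less)
  then have bound: "card {(x, y). h x y = 0 \<and> (\<Sum>s\<in>I. \<alpha> s * (x ^ k s * y ^ l s)) = 0} \<le> w s0"
    unfolding w_def by (intro footprint_bound[OF q a]) (use I s0 lq in \<open>auto simp: h_def\<close>)
  \<comment> \<open>The slack \<open>k s0 + (q + 1) * m s0\<close> vanishes only when the leading
    monomial is \<open>y ^ r\<close>. Otherwise it pays for the point
    \<open>(0, 1, 0)\<close>.\<close>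
  have w0: "w s0 + k s0 + (q + 1) * m s0 = r * (q + 1)"
    by (simp add: w_def flip: r(1)[OF s0(1)]) (simp add: algebra_simps)
  show ?thesis
  proof (cases "k s0 = 0 \<and> m s0 = 0")
    case True
    have only: "k s = 0 \<and> m s = 0 \<longleftrightarrow> s = s0" if "s \<in> I" for s
      using True that inj s0(1) r(1)[of s] r(1)[of s0] by (auto simp: inj_on_def)
    have "0 ^ k s * 1 ^ l s * 0 ^ m s = (if s = s0 then 1 else 0 :: 'a)" if "s \<in> I" for s
      using only[OF that] by (cases "k s = 0"; cases "m s = 0") (simp_all add: power_0_left)
    then have "(\<Sum>s\<in>I. \<alpha> s * (0 ^ k s * 1 ^ l s * 0 ^ m s)) = (\<Sum>s\<in>I. if s = s0 then \<alpha> s else 0)"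
      by (intro sum.cong refl) simp
    also have "\<dots> \<noteq> 0" using I s0 by simp
    finally show ?thesis using bound w0 by simp
  next
    case False
    then have "w s0 < r * (q + 1)" using w0 by auto
    then show ?thesis using bound by auto
  qed
qed

lemma card_hermitian_cone_inter_le:
  fixes a b b' c :: "'a::{field,finite}" and q :: nat and k l m n :: "'s \<Rightarrow> nat"
  defines "h \<equiv> \<lambda>x y z. y ^ q * z + y * z ^ q + a * x ^ (q + 1) + b * x ^ q * z + b' * x * z ^ q + c * z ^ (q + 1)"
  assumes q: "q \<ge> 2" "CARD('a) = q\<^sup>2" and a: "a \<noteq> 0"
    and I: "finite I" "\<And>s. s \<in> I \<Longrightarrow> \<alpha> s \<noteq> 0"
    and d: "\<And>s. s \<in> I \<Longrightarrow> k s + l s + m s + n s = d" "d \<le> q"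
    and inj: "inj_on (\<lambda>s. (k s, l s, m s, n s)) I"
    and e: "\<And>s. s \<in> I \<Longrightarrow> n s \<le> e" "\<exists>s\<in>I. n s = e" "e \<ge> 1"
  shows "card {(x, y, z, t). (x, y, z) \<noteq> (0, 0, 0) \<and> h x y z = 0 \<and>
      (\<Sum>s\<in>I. \<alpha> s * (x ^ k s * y ^ l s * z ^ m s * t ^ n s)) = 0}
    \<le> (CARD('a) - 1) * ((q ^ 3 + 1) * e + (d - e) * (q + 1) * (q\<^sup>2 - e))"
proof -
  \<comment> \<open>\<open>g\<close> is the coefficient of \<open>t ^ e\<close>. \<open>W\<close>
    collects the vectors over the lines of the cone, \<open>W0\<close> those where \<open>g\<close>
    vanishes too.\<close>
  define J where "J = {s \<in> I. n s = e}"
  define g where "g x y z = (\<Sum>s\<in>J. \<alpha> s * (x ^ k s * y ^ l s * z ^ m s))" for x y z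
  define f where "f x y z t = (\<Sum>s\<in>I. \<alpha> s * (x ^ k s * y ^ l s * z ^ m s * t ^ n s))" for x y z t
  have J: "finite J" "J \<noteq> {}" "\<And>s. s \<in> J \<Longrightarrow> \<alpha> s \<noteq> 0" "\<And>s. s \<in> J \<Longrightarrow> k s + l s + m s = d - e"
    using I d(1) e(2) by (auto simp: J_def) (metis diff_add_inverse2)
  have ed: "e \<le> d" using d(1) e(2) by fastforce
  have J_inj: "inj_on (\<lambda>s. (k s, l s, m s)) J"
    using inj by (auto simp: J_def inj_on_def)
  have h_scale: "h (u * x) (u * y) (u * z) = u ^ (q + 1) * h x y z" for u x y z
    by (simp add: h_def power_mult_distrib algebra_simps)
  have g_scale: "g (u * x) (u * y) (u * z) = u ^ (d - e) * g x y z" for u x y z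
    unfolding g_def sum_distrib_left
    by (intro sum.cong refl) (simp add: power_mult_distrib power_add algebra_simps flip: J(4))
  have h_inf: "x = 0" if "h x y 0 = 0" for x y
    using that a q by (simp add: h_def power_0_left)
  define W where "W = {(x, y, z). (x, y, z) \<noteq> (0, 0, 0) \<and> h x y z = 0}"
  define W0 where "W0 = {(x, y, z). (x, y, z) \<noteq> (0, 0, 0) \<and> h x y z = 0 \<and> g x y z = 0}"
  have h1: "h x y 1 = y ^ q + y + a * x ^ (q + 1) + b * x ^ q + b' * x + c" for x y
    by (simp add: h_def)
  have "card W \<le> (CARD('a) - 1) * (card {(x, y). h x y 1 = 0} + (if h 0 1 0 = 0 then 1 else 0))"
    unfolding W_def by (rule card_projective_solutions_le) (auto simp: h_scale dest: h_inf)
  also have "\<dots> \<le> (CARD('a) - 1) * (q ^ 3 + 1)"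
    using card_hermitian_affine_le[OF q, of "\<lambda>x. a * x ^ (q + 1) + b * x ^ q + b' * x + c"]
    by (intro mult_left_mono add_mono) (simp_all add: h1 add_ac)
  finally have W: "card W \<le> (CARD('a) - 1) * (q ^ 3 + 1)" .
  have "card W0 \<le> (CARD('a) - 1) * (card {(x, y). h x y 1 = 0 \<and> g x y 1 = 0} +
      (if h 0 1 0 = 0 \<and> g 0 1 0 = 0 then 1 else 0))"
    unfolding W0_def by (rule card_projective_solutions_le) (auto simp: h_scale g_scale dest: h_inf)
  also have "\<dots> \<le> (CARD('a) - 1) * ((d - e) * (q + 1))"
  proof (rule mult_left_mono)
    \<comment> \<open>The bound for curves requires degree below \<open>q\<close>; this is where
      \<open>e \<ge> 1\<close> and \<open>d \<le> q\<close> enter.\<close>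
    have "d - e < q" using d(2) e(3) ed q by linarith
    then have "card {(x, y). h x y 1 = 0 \<and> g x y 1 = 0} + (if g 0 1 0 = 0 then 1 else 0) \<le> (d - e) * (q + 1)"
      using card_hermitian_curve_inter_le[OF q(1) a J(1-4) _ J_inj, where b = b and b' = b' and c = c]
      by (simp only: h1 g_def power_one mult_1_right)
    then show "card {(x, y). h x y 1 = 0 \<and> g x y 1 = 0} + (if h 0 1 0 = 0 \<and> g 0 1 0 = 0 then 1 else 0)
        \<le> (d - e) * (q + 1)"
      by (auto split: if_splits)
  qed simp
  finally have W0: "card W0 \<le> (CARD('a) - 1) * ((d - e) * (q + 1))" .
  define T where "T = (\<lambda>(x, y, z). {t. f x y z t = 0})"
  have T: "card (T w) \<le> e + (if w \<in> W0 then q\<^sup>2 - e else 0)" if "w \<in> W" for w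
  proof -
    obtain x y z where w: "w = (x, y, z)" by (cases w)
    show ?thesis
    proof (cases "g x y z = 0")
      case True
      have "card (T w) \<le> CARD('a)" by (intro card_mono) auto
      then show ?thesis using True that by (simp add: w W0_def W_def q(2))
    next
      case False
      have "card {t. (\<Sum>s\<in>I. (\<alpha> s * (x ^ k s * y ^ l s * z ^ m s)) * t ^ n s) = 0} \<le> e"
        using False by (intro card_roots_le I(1) e(1)) (simp_all add: g_def J_def)
      then show ?thesis using False by (simp add: w T_def f_def W0_def mult.assoc)
    qed
  qed
  have "W0 \<subseteq> W" by (auto simp: W_def W0_def)
  have "(x, y, z, t) \<in> (\<lambda>((x, y, z), t). (x, y, z, t)) ` (SIGMA w:W. T w)"
    if "(x, y, z) \<noteq> (0, 0, 0)" "h x y z = 0" "f x y z t = 0" for x y z t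
    by (rule image_eqI[of _ _ "((x, y, z), t)"]) (use that in \<open>simp_all add: W_def T_def\<close>)
  then have "{(x, y, z, t). (x, y, z) \<noteq> (0, 0, 0) \<and> h x y z = 0 \<and> f x y z t = 0} \<subseteq>
      (\<lambda>((x, y, z), t). (x, y, z, t)) ` (SIGMA w:W. T w)"
    by blast
  then have "card {(x, y, z, t). (x, y, z) \<noteq> (0, 0, 0) \<and> h x y z = 0 \<and> f x y z t = 0}
      \<le> card (SIGMA w:W. T w)"
    by (rule surj_card_le[rotated]) simp
  also have "\<dots> = (\<Sum>w\<in>W. card (T w))" by simp
  also have "\<dots> \<le> (\<Sum>w\<in>W. e + (if w \<in> W0 then q\<^sup>2 - e else 0))"
    by (rule sum_mono) (rule T)
  also have "\<dots> = card W * e + card W0 * (q\<^sup>2 - e)"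
    using \<open>W0 \<subseteq> W\<close> sum.inter_restrict[of W "\<lambda>_. q\<^sup>2 - e" W0]
    by (simp add: sum.distrib Int_absorb1)
  also have "\<dots> \<le> (CARD('a) - 1) * (q ^ 3 + 1) * e + (CARD('a) - 1) * ((d - e) * (q + 1)) * (q\<^sup>2 - e)"
    by (intro add_mono mult_right_mono W W0) auto
  also have "\<dots> = (CARD('a) - 1) * ((q ^ 3 + 1) * e + (d - e) * (q + 1) * (q\<^sup>2 - e))"
  proof -
    have "u * v * e + u * w * z = u * (v * e + w * z)" for u v w z :: nat
      by (simp add: algebra_simps)
    then show ?thesis .
  qed
  finally show ?thesis
    unfolding f_def .
qed

text \<open>With \<open>r = d - e\<close> the right side is
  \<open>(q ^ 3 + q\<^sup>2) * e + r * (q + 1) * q\<^sup>2\<close>, which exceeds the left by at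
  least \<open>(q\<^sup>2 - 1) * e\<close>.\<close>

lemma cone_bound_less:
  fixes q d e :: nat
  assumes "q \<ge> 2" "e \<ge> 1" "e \<le> d" "d \<le> q"
  shows "(q ^ 3 + 1) * e + (d - e) * (q + 1) * (q\<^sup>2 - e) < q\<^sup>2 * d * (q + 1)"
proof -
  obtain r where d: "d = e + r" using assms(3) le_Suc_ex by blast
  have e: "1 * e < q\<^sup>2 * e"
    using assms by (intro mult_strict_right_mono one_less_power) auto
  have "(q ^ 3 + 1) * e + r * (q + 1) * (q\<^sup>2 - e) \<le> (q ^ 3 + 1) * e + r * (q + 1) * q\<^sup>2"
    by simp
  also have "\<dots> < (q ^ 3 + q\<^sup>2) * e + r * (q + 1) * q\<^sup>2"
    using e by (simp only: distrib_right add_less_cancel_left add_less_cancel_right)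
  also have "\<dots> = q\<^sup>2 * d * (q + 1)"
    by (simp add: d algebra_simps power2_eq_square power3_eq_cube)
  finally show ?thesis by (simp add: d)
qed

section \<open>Polynomials in several variables\<close>

abbreviation monom_eval :: "('n::finite \<Rightarrow>\<^sub>0 nat) \<Rightarrow> 'a::comm_monoid_mult ^ 'n \<Rightarrow> 'a" where
  "monom_eval m v \<equiv> (\<Prod>i\<in>UNIV. (v $ i) ^ Poly_Mapping.lookup m i)"

lemma mvpoly_eval_superset:
  assumes "finite A" "Poly_Mapping.keys F \<subseteq> A"
  shows "mvpoly_eval F v = (\<Sum>m\<in>A. to_ac (Poly_Mapping.lookup F m) * monom_eval m v)"
  unfolding mvpoly_eval_def
  by (rule sum.mono_neutral_left) (use assms in \<open>auto simp: in_keys_iff\<close>)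

lemma mvpoly_eval_0 [simp]: "mvpoly_eval 0 v = 0"
  by (simp add: mvpoly_eval_def)

lemma mvpoly_eval_add [simp]: "mvpoly_eval (F + G) v = mvpoly_eval F v + mvpoly_eval G v"
  using Poly_Mapping.keys_add[of F G]
  by (subst (1 2 3) mvpoly_eval_superset[of "Poly_Mapping.keys F \<union> Poly_Mapping.keys G"])
    (auto simp: lookup_add distrib_right sum.distrib)

lemma mvpoly_eval_sum: "mvpoly_eval (\<Sum>i\<in>I. f i) v = (\<Sum>i\<in>I. mvpoly_eval (f i) v)"
  by (induction I rule: infinite_finite_induct) auto

lemma mvpoly_eval_single [simp]:
  "mvpoly_eval (Poly_Mapping.single m c) v = to_ac c * monom_eval m v"
  by (subst mvpoly_eval_superset[of "{m}"]) auto

lemma mvpoly_eq_sum_single: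
  "(F :: ('k::field, 'n::finite) mvpoly) =
     (\<Sum>m\<in>Poly_Mapping.keys F. Poly_Mapping.single m (Poly_Mapping.lookup F m))"
  by (rule poly_mapping_eqI) (auto simp: lookup_sum lookup_single when_def in_keys_iff)

lemma monom_eval_add: "monom_eval (m + n) v = monom_eval m v * monom_eval n v"
  by (simp add: lookup_add power_add prod.distrib)

lemma mvpoly_eval_mult [simp]:
  fixes F G :: "('k::field, 'n::finite) mvpoly"
  shows "mvpoly_eval (F * G) v = mvpoly_eval F v * mvpoly_eval G v"
proof -
  have "F * G = (\<Sum>m\<in>Poly_Mapping.keys F. \<Sum>n\<in>Poly_Mapping.keys G.
      Poly_Mapping.single (m + n) (Poly_Mapping.lookup F m * Poly_Mapping.lookup G n))"
    by (subst (1) mvpoly_eq_sum_single[of F], subst (1) mvpoly_eq_sum_single[of G])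
      (simp add: sum_product mult_single)
  then have "mvpoly_eval (F * G) v = (\<Sum>m\<in>Poly_Mapping.keys F. \<Sum>n\<in>Poly_Mapping.keys G.
      (to_ac (Poly_Mapping.lookup F m) * monom_eval m v) *
      (to_ac (Poly_Mapping.lookup G n) * monom_eval n v))"
    by (simp only: mvpoly_eval_sum mvpoly_eval_single to_ac_mult monom_eval_add mult_ac)
  then show ?thesis
    by (simp add: mvpoly_eval_def sum_product)
qed

lemma mvpoly_eval_1 [simp]: "mvpoly_eval 1 v = 1"
  using mvpoly_eval_single[of 0 1 v] by simp

lemma mvpoly_eval_prod:
  fixes f :: "'i \<Rightarrow> ('k::field, 'n::finite) mvpoly"
  shows "mvpoly_eval (\<Prod>i\<in>I. f i) v = (\<Prod>i\<in>I. mvpoly_eval (f i) v)"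
  by (induction I rule: infinite_finite_induct) auto

lemma mvpoly_eval_power:
  fixes F :: "('k::field, 'n::finite) mvpoly"
  shows "mvpoly_eval (F ^ e) v = mvpoly_eval F v ^ e"
  by (induction e) auto

lemma homogeneous_0: "homogeneous d 0"
  by (simp add: homogeneous_def)

lemma homogeneous_add: "homogeneous d F \<Longrightarrow> homogeneous d G \<Longrightarrow> homogeneous d (F + G)"
  using Poly_Mapping.keys_add[of F G] unfolding homogeneous_def by blast

lemma homogeneous_sum: "(\<And>i. i \<in> I \<Longrightarrow> homogeneous d (f i)) \<Longrightarrow> homogeneous d (\<Sum>i\<in>I. f i)"
  by (induction I rule: infinite_finite_induct) (auto simp: homogeneous_0 homogeneous_add)

lemma homogeneous_single:
  "(\<Sum>i\<in>UNIV. Poly_Mapping.lookup m i) = d \<Longrightarrow> homogeneous d (Poly_Mapping.single m c)"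
  by (auto simp: homogeneous_def split: if_splits)

lemma homogeneous_mult:
  fixes F G :: "('k::field, 'n::finite) mvpoly"
  assumes "homogeneous d F" "homogeneous e G"
  shows "homogeneous (d + e) (F * G)"
  unfolding homogeneous_def
proof
  fix m assume "m \<in> Poly_Mapping.keys (F * G)"
  then obtain a b where "m = a + b" "a \<in> Poly_Mapping.keys F" "b \<in> Poly_Mapping.keys G"
    using Poly_Mapping.keys_mult[of F G] by blast
  then show "(\<Sum>i\<in>UNIV. Poly_Mapping.lookup m i) = d + e"
    using assms by (simp add: homogeneous_def lookup_add sum.distrib)
qed

lemma homogeneous_1: "homogeneous 0 (1 :: ('k::field, 'n::finite) mvpoly)"
  by (simp add: homogeneous_def)

lemma homogeneous_power:
  fixes F :: "('k::field, 'n::finite) mvpoly"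
  shows "homogeneous d F \<Longrightarrow> homogeneous (e * d) (F ^ e)"
  by (induction e) (auto intro: homogeneous_1 homogeneous_mult)

lemma homogeneous_prod:
  fixes f :: "'i \<Rightarrow> ('k::field, 'n::finite) mvpoly"
  shows "finite I \<Longrightarrow> (\<And>i. i \<in> I \<Longrightarrow> homogeneous (d i) (f i)) \<Longrightarrow> homogeneous (\<Sum>i\<in>I. d i) (\<Prod>i\<in>I. f i)"
  by (induction I rule: finite_induct) (auto intro: homogeneous_1 homogeneous_mult)

text \<open>Each variable \<open>i\<close> is replaced by the linear form \<open>L i\<close> from
  row \<open>i\<close> of \<open>T\<close>. A square \<open>T\<close> changes coordinates; a
  \<open>4 \<times> 3\<close> one restricts a surface to a plane.\<close>

lemma ex_mvpoly_linear_substitution: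
  fixes F :: "('k::field, 'n::finite) mvpoly" and T :: "'k ^ 'm::finite ^ 'n"
  assumes "homogeneous d F"
  shows "\<exists>G :: ('k, 'm) mvpoly. homogeneous d G \<and>
           (\<forall>x. mvpoly_eval G x = mvpoly_eval F (map_matrix to_ac T *v x))"
proof -
  define L :: "'n \<Rightarrow> ('k, 'm) mvpoly" where
    "L i = (\<Sum>j\<in>UNIV. Poly_Mapping.single (Poly_Mapping.single j 1) (T $ i $ j))" for i
  define G where "G = (\<Sum>m\<in>Poly_Mapping.keys F.
    Poly_Mapping.single 0 (Poly_Mapping.lookup F m) * (\<Prod>i\<in>UNIV. L i ^ Poly_Mapping.lookup m i))"
  have hL: "homogeneous 1 (L i)" for i
    unfolding L_def
    by (intro homogeneous_sum homogeneous_single) (simp add: lookup_single when_def)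
  have "monom_eval (Poly_Mapping.single j (1::nat)) x = x $ j" for j and x :: "'k alg_closure ^ 'm"
    by (simp add: lookup_single when_def if_distrib[of "\<lambda>e. _ ^ e"] cong: if_cong)
  then have eval_L: "mvpoly_eval (L i) x = (map_matrix to_ac T *v x) $ i" for i x
    by (simp add: L_def mvpoly_eval_sum matrix_vector_mult_def)
  have "homogeneous d G"
    unfolding G_def
  proof (rule homogeneous_sum)
    fix m assume "m \<in> Poly_Mapping.keys F"
    then have "(\<Sum>i\<in>UNIV. Poly_Mapping.lookup m i * 1) = d"
      using assms by (simp add: homogeneous_def)
    then show "homogeneous d (Poly_Mapping.single 0 (Poly_Mapping.lookup F m) *
        (\<Prod>i\<in>UNIV. L i ^ Poly_Mapping.lookup m i))"
      using homogeneous_mult[OF homogeneous_single[of 0 0 "Poly_Mapping.lookup F m"]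
          homogeneous_prod[OF finite homogeneous_power[OF hL]]] by fastforce
  qed
  moreover have "mvpoly_eval G x = mvpoly_eval F (map_matrix to_ac T *v x)" for x
    by (simp add: G_def mvpoly_eval_sum mvpoly_eval_prod mvpoly_eval_power eval_L)
      (simp add: mvpoly_eval_def)
  ultimately show ?thesis by blast
qed

section \<open>Nonzero polynomials as nonzero functions over the closure\<close>

lemma base_expansion_unique:
  fixes a b :: "nat \<Rightarrow> nat"
  assumes "\<And>k. k < n \<Longrightarrow> a k < B" "\<And>k. k < n \<Longrightarrow> b k < B"
    and "(\<Sum>k<n. a k * B ^ k) = (\<Sum>k<n. b k * B ^ k)" "k < n"
  shows "a k = b k"
  using assms
proof (induction n arbitrary: a b k)
  case (Suc n)
  have split: "(\<Sum>k<Suc n. f k * B ^ k) = f 0 + B * (\<Sum>k<n. f (Suc k) * B ^ k)" for f :: "nat \<Rightarrow> nat"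
    by (subst sum.lessThan_Suc_shift) (simp add: sum_distrib_left mult_ac)
  have eq: "a 0 + B * (\<Sum>k<n. a (Suc k) * B ^ k) = b 0 + B * (\<Sum>k<n. b (Suc k) * B ^ k)"
    using Suc.prems(3) by (simp only: split)
  have "a 0 = b 0"
    using arg_cong[OF eq, of "\<lambda>t. t mod B"] Suc.prems(1)[of 0] Suc.prems(2)[of 0] by simp
  moreover have "a (Suc k) = b (Suc k)" if "k < n" for k
  proof (rule Suc.IH[of "\<lambda>k. a (Suc k)" "\<lambda>k. b (Suc k)"])
    show "(\<Sum>k<n. a (Suc k) * B ^ k) = (\<Sum>k<n. b (Suc k) * B ^ k)"
      using eq calculation Suc.prems(1)[of 0] by auto
  qed (use Suc.prems that in auto)
  ultimately show ?case
    using Suc.prems(4) by (cases k) auto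
qed auto

text \<open>If the field were finite, adding 1 to the product of all \<open>X - a\<close> would give
  a nonconstant polynomial without roots.\<close>

lemma infinite_UNIV_alg_closed: "infinite (UNIV :: 'a::alg_closed_field set)"
proof
  assume fin: "finite (UNIV :: 'a set)"
  define p where "p = (\<Prod>a\<in>(UNIV::'a set). [:- a, 1:])"
  have deg: "Polynomial.degree p = CARD('a)"
    unfolding p_def by (subst degree_prod_eq_sum_degree) auto
  have "CARD('a) > 0" using fin by (simp add: finite_UNIV_card_ge_0)
  then have "Polynomial.degree (p + 1) > 0"
    using deg by (subst degree_add_eq_left) auto
  then obtain x where "poly (p + 1) x = 0"
    using alg_closed_imp_poly_has_root by blast
  moreover have "poly p x = 0"
    unfolding p_def poly_prod using fin by (intro prod_zero) auto
  ultimately show False by simp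
qed

text \<open>
  Kronecker substitution: sending the variables to \<open>s, s ^ B, s ^ (B ^ 2), \<dots>\<close> keeps monomials with exponents
  below \<open>B\<close> apart.
\<close>

lemma ex_mvpoly_eval_nonzero:
  fixes F :: "('k::field, 'n::finite) mvpoly"
  assumes "F \<noteq> 0"
  shows "\<exists>v. mvpoly_eval F v \<noteq> 0"
proof -
  obtain h where h: "bij_betw h (UNIV :: 'n set) {..<CARD('n)}"
    using ex_bij_betw_finite_nat[of "UNIV :: 'n set"] by (auto simp: atLeast0LessThan)
  define B where "B = Suc (\<Sum>m\<in>Poly_Mapping.keys F. \<Sum>i\<in>UNIV. Poly_Mapping.lookup m i)"
  have B: "Poly_Mapping.lookup m i < B" if "m \<in> Poly_Mapping.keys F" for m i
  proof -
    have "Poly_Mapping.lookup m i \<le> (\<Sum>i\<in>UNIV. Poly_Mapping.lookup m i)"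
      by (rule member_le_sum) auto
    also have "\<dots> \<le> (\<Sum>m\<in>Poly_Mapping.keys F. \<Sum>i\<in>UNIV. Poly_Mapping.lookup m i)"
      by (rule member_le_sum[OF that]) auto
    finally show ?thesis by (simp add: B_def)
  qed
  define N where "N m = (\<Sum>i\<in>UNIV. Poly_Mapping.lookup m i * B ^ h i)" for m
  define g where "g = inv_into UNIV h"
  have gh: "g (h i) = i" for i
    using h by (simp add: g_def bij_betw_def)
  have N: "N m = (\<Sum>k<CARD('n). Poly_Mapping.lookup m (g k) * B ^ k)" for m
    unfolding N_def by (subst sum.reindex_bij_betw[OF h, symmetric]) (simp add: gh)
  have inj: "inj_on N (Poly_Mapping.keys F)"
  proof (rule inj_onI)
    fix m m' assume *: "m \<in> Poly_Mapping.keys F" "m' \<in> Poly_Mapping.keys F" "N m = N m'"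
    have "Poly_Mapping.lookup m (g k) = Poly_Mapping.lookup m' (g k)" if "k < CARD('n)" for k
      by (rule base_expansion_unique[of "CARD('n)" _ B])
        (use * that B in \<open>auto simp: N\<close>)
    moreover have "h i < CARD('n)" for i
      using h by (auto simp: bij_betw_def)
    ultimately show "m = m'"
      by (metis gh poly_mapping_eqI)
  qed
  define p where "p = (\<Sum>m\<in>Poly_Mapping.keys F. Polynomial.monom (to_ac (Poly_Mapping.lookup F m)) (N m))"
  obtain m0 where m0: "m0 \<in> Poly_Mapping.keys F"
    using assms by (auto simp: poly_mapping_eq_iff fun_eq_iff in_keys_iff)
  have "Polynomial.coeff p (N m0) = (\<Sum>m\<in>Poly_Mapping.keys F. if m = m0 then to_ac (Poly_Mapping.lookup F m) else 0)"
    unfolding p_def coeff_sum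
    by (intro sum.cong refl) (use inj m0 in \<open>auto simp: inj_on_def\<close>)
  also have "\<dots> \<noteq> 0"
    using m0 by (simp add: in_keys_iff)
  finally have "p \<noteq> 0" by auto
  then obtain s where s: "poly p s \<noteq> 0"
    using poly_roots_finite[of p] infinite_UNIV_alg_closed by (metis (mono_tags) UNIV_eq_I mem_Collect_eq)
  have "mvpoly_eval F (\<chi> i. s ^ (B ^ h i)) = poly p s"
    unfolding mvpoly_eval_def p_def N_def
    by (simp add: poly_sum poly_monom power_sum power_mult[symmetric] mult.commute)
  then show ?thesis using s by metis
qed

section \<open>Rational points and frames\<close>

definition ac_vec :: "'k::field ^ 'n::finite \<Rightarrow> 'k alg_closure ^ 'n" where
  "ac_vec v = (\<chi> i. to_ac (v $ i))"

lemma ac_vec_nth [simp]: "ac_vec v $ i = to_ac (v $ i)"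
  by (simp add: ac_vec_def)

lemma ac_vec_eq_iff [simp]: "ac_vec v = ac_vec w \<longleftrightarrow> v = w"
  by (auto simp: vec_eq_iff)

lemma ac_vec_0 [simp]: "ac_vec 0 = 0"
  by (simp add: vec_eq_iff)

lemma ac_vec_eq_0_iff [simp]: "ac_vec v = 0 \<longleftrightarrow> v = 0"
  using ac_vec_eq_iff[of v 0] by simp

lemma ac_vec_add: "ac_vec (v + w) = ac_vec v + ac_vec w"
  by (simp add: vec_eq_iff)

lemma ac_vec_scale: "ac_vec (c *s v) = to_ac c *s ac_vec v"
  by (simp add: vec_eq_iff)

lemma ac_vec_matrix: "ac_vec (M *v s) = map_matrix to_ac M *v ac_vec s"
  by (simp add: vec_eq_iff matrix_vector_mult_def to_ac_sum)

lemma map_matrix_to_ac_mult: "map_matrix to_ac (A ** B) = map_matrix to_ac A ** map_matrix to_ac B"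
  by (simp add: vec_eq_iff matrix_matrix_mult_def to_ac_sum)

lemma map_matrix_to_ac_mat_1: "map_matrix to_ac (mat 1) = mat 1"
  by (simp add: vec_eq_iff mat_def)

lemma invertible_map_matrix_to_ac:
  "invertible (T :: 'k::field ^ 'n ^ 'n) \<Longrightarrow> invertible (map_matrix to_ac T)"
  unfolding invertible_def by (metis map_matrix_to_ac_mult map_matrix_to_ac_mat_1)

lemma proj_point_eq_iff:
  assumes "v \<noteq> 0" "w \<noteq> 0"
  shows "proj_point v = proj_point w \<longleftrightarrow> (\<exists>c. c \<noteq> 0 \<and> w = c *s v)"
proof
  assume "proj_point v = proj_point w"
  then have "w \<in> vec.span {v}"
    unfolding proj_point_def by (simp add: vec.span_base)
  then obtain c where "w = c *s v"
    by (auto simp: vec.span_singleton)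
  then show "\<exists>c. c \<noteq> 0 \<and> w = c *s v"
    using assms by (intro exI[of _ c]) auto
next
  assume "\<exists>c. c \<noteq> 0 \<and> w = c *s v"
  then obtain c where c: "c \<noteq> 0" "w = c *s v" by blast
  then have "v = (1 / c) *s w"
    by (simp add: vec.scale_scale)
  then have "\<exists>b. a *s v = b *s w" "\<exists>b. a *s w = b *s v" for a
    using c by (metis vec.scale_scale)+
  then show "proj_point v = proj_point w"
    unfolding proj_point_def vec.span_singleton by (auto simp: image_def)
qed

lemma proj_point_in_iff:
  assumes "\<And>c v. c \<noteq> 0 \<Longrightarrow> v \<noteq> 0 \<Longrightarrow> \<Phi> v \<Longrightarrow> \<Phi> (c *s v)" "v \<noteq> 0"
  shows "proj_point v \<in> {proj_point w | w. w \<noteq> 0 \<and> \<Phi> w} \<longleftrightarrow> \<Phi> v"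
proof
  assume "proj_point v \<in> {proj_point w | w. w \<noteq> 0 \<and> \<Phi> w}"
  then obtain w where "w \<noteq> 0" "\<Phi> w" "proj_point w = proj_point v" by auto
  then show "\<Phi> v"
    using assms proj_point_eq_iff by metis
qed (use assms in blast)

lemma proj_point_in_proj_space [simp]: "v \<noteq> 0 \<Longrightarrow> proj_point v \<in> proj_space"
  by (auto simp: proj_space_def)

text \<open>The rational vectors over a rational point are the nonzero multiples, by scalars in
  \<open>'k\<close>, of any one of them.\<close>

lemma card_vectors_over_points:
  fixes Y :: "('k::{field,finite}, 'n::finite) ppoint set"
  shows "card {v :: 'k ^ 'n. v \<noteq> 0 \<and> proj_point (ac_vec v) \<in> Y}
    = (CARD('k) - 1) * card (rational_points Y)"
proof -
  define fiber where "fiber p = {v :: 'k ^ 'n. v \<noteq> 0 \<and> proj_point (ac_vec v) = p}" for p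
  have rat: "rational_points Y = (\<lambda>v. proj_point (ac_vec v)) ` {v :: 'k ^ 'n. v \<noteq> 0 \<and> proj_point (ac_vec v) \<in> Y}"
    by (auto simp: rational_points_def ac_vec_def)
  have "card (fiber p) = CARD('k) - 1" if p: "p \<in> rational_points Y" for p
  proof -
    obtain v0 :: "'k ^ 'n" where v0: "v0 \<noteq> 0" "p = proj_point (ac_vec v0)"
      using p rat by auto
    have "fiber p = (\<lambda>c. c *s v0) ` (UNIV - {0})"
    proof (rule Set.set_eqI)
      fix v
      show "v \<in> fiber p \<longleftrightarrow> v \<in> (\<lambda>c. c *s v0) ` (UNIV - {0})"
      proof
        assume "v \<in> fiber p"
        then have v: "v \<noteq> 0" "proj_point (ac_vec v0) = proj_point (ac_vec v)"
          using v0 by (auto simp: fiber_def)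
        then obtain c where c: "ac_vec v = c *s ac_vec v0"
          using proj_point_eq_iff[of "ac_vec v0" "ac_vec v"] v0 by auto
        obtain i where i: "v0 $ i \<noteq> 0"
          using v0 by (auto simp: vec_eq_iff)
        have "to_ac (v $ i) = c * to_ac (v0 $ i)"
          using arg_cong[OF c, of "\<lambda>x. x $ i"] by simp
        \<comment> \<open>A priori the factor lies in the closure; as a quotient of rational
          coordinates it comes from \<open>'k\<close>.\<close>
        then have "c = to_ac (v $ i / v0 $ i)"
          using i by (simp add: field_simps)
        then have "v = (v $ i / v0 $ i) *s v0"
          using c by (metis ac_vec_eq_iff ac_vec_scale)
        then show "v \<in> (\<lambda>c. c *s v0) ` (UNIV - {0})"
          using v(1) by (metis DiffI UNIV_I image_eqI singletonD vec.scale_zero_left)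
      next
        assume "v \<in> (\<lambda>c. c *s v0) ` (UNIV - {0})"
        then obtain c where c: "c \<noteq> 0" "v = c *s v0" by auto
        then have "v \<noteq> 0" using v0 by auto
        moreover have "proj_point (ac_vec v0) = proj_point (ac_vec v)"
          using c v0 \<open>v \<noteq> 0\<close> by (subst proj_point_eq_iff) (auto simp: ac_vec_scale intro!: exI[of _ "to_ac c"])
        ultimately show "v \<in> fiber p" using v0 by (simp add: fiber_def)
      qed
    qed
    moreover have "inj_on (\<lambda>c. c *s v0) (UNIV - {0})"
      using v0 by (auto simp: inj_on_def)
    ultimately show ?thesis
      by (simp add: card_image card_Diff_singleton)
  qed
  moreover have "{v :: 'k ^ 'n. v \<noteq> 0 \<and> proj_point (ac_vec v) \<in> Y} = (\<Union>p\<in>rational_points Y. fiber p)"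
    unfolding rat by (auto simp: fiber_def)
  moreover have "card (\<Union>p\<in>rational_points Y. fiber p) = (\<Sum>p\<in>rational_points Y. card (fiber p))"
  proof (rule card_UN_disjoint)
    show "finite (rational_points Y)" unfolding rat by simp
  qed (auto simp: fiber_def)
  ultimately show ?thesis by (simp add: mult.commute)
qed

section \<open>Coordinates given by a plane and a point off it\<close>

lemma frame_map_proj_point:
  "frame_map M (proj_point s) = proj_point (map_matrix to_ac M *v s)"
  by (auto simp: frame_map_def proj_point_def vec.span_singleton image_image
      vec.scale matrix_vector_mult_scaleR vector_scalar_commute)

text \<open>The matrix of the change of coordinates that turns the point \<open>[p]\<close> into
  \<open>[0:0:0:1]\<close> and the plane of \<open>M\<close> into the plane where the last
  coordinate is 0.\<close>

definition adjoin_column :: "'a ^ 3 ^ 4 \<Rightarrow> 'a ^ 4 \<Rightarrow> 'a ^ 4 ^ 4" where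
  "adjoin_column M p = (\<chi> i j. if j = 1 then M $ i $ 1 else if j = 2 then M $ i $ 2
     else if j = 3 then M $ i $ 3 else p $ i)"

definition vec4 :: "'a \<Rightarrow> 'a \<Rightarrow> 'a \<Rightarrow> 'a \<Rightarrow> 'a ^ 4" where
  "vec4 x y z t = (\<chi> j. if j = 1 then x else if j = 2 then y else if j = 3 then z else t)"

lemma vec4_nth [simp]:
  "vec4 x y z t $ 1 = x" "vec4 x y z t $ 2 = y" "vec4 x y z t $ 3 = z" "vec4 x y z t $ 4 = t"
  by (simp_all add: vec4_def)

lemma vec4_eta: "vec4 (x $ 1) (x $ 2) (x $ 3) (x $ 4) = x"
  by (simp add: vec_eq_iff forall_4)

lemma vector3_eta: "vector [s $ 1, s $ 2, s $ 3] = (s :: 'a::zero ^ 3)"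
  by (simp add: vec_eq_iff forall_3)

lemma adjoin_column_mult:
  fixes M :: "'a::field ^ 3 ^ 4"
  shows "adjoin_column M p *v vec4 x y z t = M *v vector [x, y, z] + t *s p"
  by (simp add: adjoin_column_def vec_eq_iff matrix_vector_mult_def sum_3 sum_4 mult.commute)

lemma map_matrix_adjoin_column:
  "map_matrix to_ac (adjoin_column M p) = adjoin_column (map_matrix to_ac M) (ac_vec p)"
  by (simp add: adjoin_column_def vec_eq_iff)

text \<open>Provides the coordinates \<open>(s, t)\<close> used for all cones: \<open>s\<close>
  picks the line through \<open>[p]\<close>, and \<open>t\<close> the position on it.\<close>

lemma bij_adjoin_column:
  fixes M :: "'a::field ^ 3 ^ 4"
  assumes "invertible (adjoin_column M p)"
  shows "bij (\<lambda>(s, t). M *v s + t *s p)"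
proof -
  let ?T = "adjoin_column M p"
  have T: "M *v s + t *s p = ?T *v vec4 (s $ 1) (s $ 2) (s $ 3) t" for s t
    by (simp add: adjoin_column_mult vector3_eta)
  have bij: "bij ((*v) ?T)"
    using assms unfolding bij_def invertible_def
    by (metis matrix_left_invertible_injective matrix_right_invertible_surjective)
  have "bij (\<lambda>(s :: 'a ^ 3, t). vec4 (s $ 1) (s $ 2) (s $ 3) t)"
  proof (rule bijI)
    show "inj (\<lambda>(s :: 'a ^ 3, t). vec4 (s $ 1) (s $ 2) (s $ 3) t)"
      by (auto simp: inj_def vec_eq_iff[where 'b = 4] vec_eq_iff[where 'b = 3] forall_4 forall_3)
    show "surj (\<lambda>(s :: 'a ^ 3, t). vec4 (s $ 1) (s $ 2) (s $ 3) t)"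
    proof -
      have "x \<in> range (\<lambda>(s :: 'a ^ 3, t). vec4 (s $ 1) (s $ 2) (s $ 3) t)" for x
        by (rule image_eqI[of _ _ "(vector [x $ 1, x $ 2, x $ 3], x $ 4)"]) (simp_all add: vec4_eta)
      then show ?thesis by blast
    qed
  qed
  from bij_comp[OF this bij] show ?thesis
    by (simp add: T comp_def case_prod_unfold)
qed

lemma full_column_rank_injective:
  fixes M :: "'a::field ^ 'n ^ 'm"
  assumes "rank M = CARD('n)"
  shows "inj ((*v) M)"
proof -
  have "vec.span (rows M) = UNIV"
    using assms unfolding row_rank_def_gen
    by (metis vec_dim_card vec.dim_eq_full vec.dimension_def vec.dim_UNIV)
  then show ?thesis
    using matrix_left_invertible_span_rows_gen matrix_left_invertible_injective by blast
qed

text \<open>The kernel is trivial: a relation with \<open>t\<close> nonzero would express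
  \<open>p\<close> by the columns of \<open>M\<close> and put its point on the plane, and
  \<open>t = 0\<close> is settled by injectivity.\<close>

lemma invertible_adjoin_column:
  fixes M :: "'k::field ^ 3 ^ 4"
  assumes "inj ((*v) M)" "p \<noteq> 0" "proj_point (ac_vec p) \<notin> plane_of M"
  shows "invertible (adjoin_column M p)"
proof -
  have "x = 0" if "adjoin_column M p *v x = 0" for x
  proof -
    define s t where "s = (vector [x $ 1, x $ 2, x $ 3] :: 'k ^ 3)" and "t = x $ 4"
    have eq: "M *v s + t *s p = 0"
      using that adjoin_column_mult[of M p "x $ 1" "x $ 2" "x $ 3" "x $ 4"]
      by (simp add: vec4_eta s_def t_def)
    have "t = 0"
    proof (rule ccontr)
      assume t: "t \<noteq> 0"
      define s' where "s' = (- 1 / t) *s s"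
      have "p = (1 / t) *s (t *s p)"
        using t by (simp add: vec.scale_scale)
      also have "t *s p = - (M *v s)"
        using eq by (simp add: eq_neg_iff_add_eq_0 add.commute)
      also have "(1 / t) *s - (M *v s) = (- 1 / t) *s (M *v s)"
        by (simp add: vec_eq_iff)
      also have "(- 1 / t) *s (M *v s) = M *v s'"
        by (simp only: vector_scalar_commute s'_def)
      finally have p: "p = M *v s'" .
      have "s' \<noteq> 0"
        using p assms(2) by auto
      then have "frame_map M (proj_point (ac_vec s')) \<in> plane_of M"
        unfolding plane_of_def by (intro imageI proj_point_in_proj_space) simp
      moreover have "frame_map M (proj_point (ac_vec s')) = proj_point (ac_vec p)"
        unfolding frame_map_proj_point p by (simp add: ac_vec_matrix)
      ultimately show False using assms(3) by simp
    qed
    moreover from this eq have "M *v s = M *v 0" by simp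
    then have "s = 0" using assms(1) by (metis injD)
    ultimately show "x = 0"
      by (simp add: s_def t_def vec_eq_iff forall_3 forall_4)
  qed
  then show ?thesis
    using matrix_left_invertible_ker invertible_left_inverse by blast
qed

section \<open>Cones\<close>

lemma bij_frameD:
  fixes M :: "'a::field ^ 3 ^ 4"
  assumes "bij (\<lambda>(s, t). M *v s + t *s p)"
  shows "M *v s + t *s p = M *v s' + t' *s p \<longleftrightarrow> s = s' \<and> t = t'"
    and "M *v s + t *s p = 0 \<longleftrightarrow> s = 0 \<and> t = 0"
    and "\<exists>s t. v = M *v s + t *s p"
proof -
  show 1: "M *v s + t *s p = M *v s' + t' *s p \<longleftrightarrow> s = s' \<and> t = t'" for s t s' t'
    using bij_is_inj[OF assms] by (auto simp: inj_def)
  show "M *v s + t *s p = 0 \<longleftrightarrow> s = 0 \<and> t = 0"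
    using 1[of s t 0 0] by simp
  show "\<exists>s t. v = M *v s + t *s p"
    using bij_is_surj[OF assms] by (force simp: surj_def)
qed

lemma mem_span_two_points:
  "x \<in> vec.span (proj_point v \<union> proj_point w) \<longleftrightarrow> (\<exists>a b. x = a *s v + b *s w)"
  unfolding proj_point_def vec.span_Un vec.span_span
  by (auto simp: vec.span_singleton)

lemma proj_point_in_line_iff:
  assumes "x \<noteq> 0"
  shows "proj_point x \<in> line_through (proj_point v) (proj_point w) \<longleftrightarrow> (\<exists>a b. x = a *s v + b *s w)"
proof -
  have "proj_point x \<subseteq> vec.span (proj_point v \<union> proj_point w) \<longleftrightarrow>
      x \<in> vec.span (proj_point v \<union> proj_point w)"
    unfolding proj_point_def
    using vec.span_minimal[OF _ vec.subspace_span, of "{x}" "vec.span {v} \<union> vec.span {w}"]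
      vec.span_base[of x "{x}"] by auto
  then show ?thesis
    using assms by (simp add: line_through_def mem_span_two_points)
qed

text \<open>Joining \<open>[p]\<close> to a base point \<open>[s']\<close> gives the vectors whose
  \<open>s\<close> is a multiple of \<open>s'\<close>, with any \<open>t\<close>. The case
  \<open>s = 0\<close> is the vertex, which a cone over an empty base does not contain.\<close>

lemma proj_point_in_cone_iff:
  fixes M :: "'k::field ^ 3 ^ 4"
  assumes bij: "bij (\<lambda>(s, t). map_matrix to_ac M *v s + t *s p)"
    and Y: "Y \<subseteq> proj_space" and st: "s \<noteq> 0 \<or> t \<noteq> 0"
  shows "proj_point (map_matrix to_ac M *v s + t *s p) \<in> proj_cone (proj_point p) (frame_map M ` Y) \<longleftrightarrow>
    (if s = 0 then Y \<noteq> {} else proj_point s \<in> Y)"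
proof -
  let ?v = "map_matrix to_ac M *v s + t *s p"
  have v: "?v \<noteq> 0"
    using bij_frameD(2)[OF bij] st by blast
  have line: "proj_point ?v \<in> line_through (proj_point p) (frame_map M (proj_point s')) \<longleftrightarrow>
      (\<exists>b. s = b *s s')" for s'
  proof -
    have "a *s p + b *s (map_matrix to_ac M *v s') = map_matrix to_ac M *v (b *s s') + a *s p" for a b
      by (simp only: vector_scalar_commute add.commute)
    then have "?v = a *s p + b *s (map_matrix to_ac M *v s') \<longleftrightarrow> s = b *s s' \<and> t = a" for a b
      by (simp only: bij_frameD(1)[OF bij])
    then show ?thesis
      unfolding frame_map_proj_point proj_point_in_line_iff[OF v] by simp
  qed
  have Y': "\<exists>s'. s' \<noteq> 0 \<and> Q = proj_point s'" if "Q \<in> Y" for Q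
    using that Y by (auto simp: proj_space_def)
  show ?thesis
  proof (cases "s = 0")
    case True
    then have "proj_point ?v \<in> line_through (proj_point p) (frame_map M Q)" if "Q \<in> Y" for Q
    proof -
      from Y'[OF that] obtain s' where "Q = proj_point s'" by blast
      then show ?thesis
        using line[of s'] True by (auto intro: exI[of _ 0])
    qed
    then show ?thesis
      using True by (auto simp: proj_cone_def)
  next
    case False
    have "proj_point ?v \<in> proj_cone (proj_point p) (frame_map M ` Y) \<longleftrightarrow>
        (\<exists>s'. s' \<noteq> 0 \<and> proj_point s' \<in> Y \<and> (\<exists>b. s = b *s s'))"
    proof
      assume "proj_point ?v \<in> proj_cone (proj_point p) (frame_map M ` Y)"
      then obtain Q where Q: "Q \<in> Y" "proj_point ?v \<in> line_through (proj_point p) (frame_map M Q)"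
        by (auto simp: proj_cone_def)
      from Y'[OF Q(1)] obtain s' where "s' \<noteq> 0" "Q = proj_point s'" by blast
      with Q line[of s'] show "\<exists>s'. s' \<noteq> 0 \<and> proj_point s' \<in> Y \<and> (\<exists>b. s = b *s s')"
        by (intro exI[of _ s']) simp
    next
      assume "\<exists>s'. s' \<noteq> 0 \<and> proj_point s' \<in> Y \<and> (\<exists>b. s = b *s s')"
      then obtain s' where s': "proj_point s' \<in> Y" "\<exists>b. s = b *s s'" by auto
      with line[of s'] show "proj_point ?v \<in> proj_cone (proj_point p) (frame_map M ` Y)"
        unfolding proj_cone_def by (intro UN_I[of "frame_map M (proj_point s')"] imageI) simp_all
    qed
    also have "\<dots> \<longleftrightarrow> proj_point s \<in> Y"
    proof
      assume "\<exists>s'. s' \<noteq> 0 \<and> proj_point s' \<in> Y \<and> (\<exists>b. s = b *s s')"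
      then obtain s' b where *: "s' \<noteq> 0" "proj_point s' \<in> Y" "s = b *s s'" by blast
      then have "b \<noteq> 0" using False by auto
      then have "proj_point s' = proj_point s"
        using * False proj_point_eq_iff[of s' s] by auto
      then show "proj_point s \<in> Y" using * by simp
    next
      assume "proj_point s \<in> Y"
      then show "\<exists>s'. s' \<noteq> 0 \<and> proj_point s' \<in> Y \<and> (\<exists>b. s = b *s s')"
        using False by (intro exI[of _ s] conjI exI[of _ 1]) auto
    qed
    finally show ?thesis using False by simp
  qed
qed

text \<open>
  The assumption on translation says that \<open>S\<close> is a union of lines through \<open>[p]\<close>, without reference to
  a base curve, since the base curves of the two cones may lie in different planes.
\<close>

lemma card_rational_points_cone_inter:
  fixes M :: "'k::{field,finite} ^ 3 ^ 4" and S :: "('k, 4) ppoint set"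
  assumes inv: "invertible (adjoin_column M p)"
    and S: "\<And>v t. (\<And>a. v \<noteq> a *s ac_vec p) \<Longrightarrow> proj_point (v + t *s ac_vec p) \<in> S \<longleftrightarrow> proj_point v \<in> S"
    and pS: "proj_point (ac_vec p) \<in> S"
    and Y: "Y \<subseteq> proj_space" "Y \<noteq> {}"
  shows "card (rational_points (S \<inter> proj_cone (proj_point (ac_vec p)) (frame_map M ` Y))) =
    1 + CARD('k) * card (rational_points (frame_map M ` Y \<inter> S))"
proof -
  let ?M = "map_matrix to_ac M" and ?p = "ac_vec p" and ?Q = "CARD('k)"
  define C where "C = frame_map M ` Y"
  define V where "V = proj_cone (proj_point ?p) C"
  note bijK = bij_adjoin_column[OF inv]
  have bijA: "bij (\<lambda>(s, t). ?M *v s + t *s ?p)"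
    using bij_adjoin_column[of ?M ?p] invertible_map_matrix_to_ac[OF inv]
    by (simp add: map_matrix_adjoin_column)
  note cone = proj_point_in_cone_iff[OF bijA Y(1), folded C_def, folded V_def]
  have ac: "ac_vec (M *v s + t *s p) = ?M *v ac_vec s + to_ac t *s ?p" for s t
    by (simp add: ac_vec_add ac_vec_scale ac_vec_matrix)
  have inC: "proj_point (?M *v s + t *s ?p) \<in> C \<longleftrightarrow> t = 0 \<and> s \<noteq> 0 \<and> proj_point s \<in> Y"
    if "s \<noteq> 0 \<or> t \<noteq> 0" for s t
  proof
    assume "proj_point (?M *v s + t *s ?p) \<in> C"
    then obtain R where R: "R \<in> Y" "frame_map M R = proj_point (?M *v s + t *s ?p)"
      by (auto simp: C_def)
    obtain s' where "s' \<noteq> 0" "R = proj_point s'"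
      using R(1) Y(1) by (auto simp: proj_space_def)
    with R have s': "s' \<noteq> 0" "proj_point s' \<in> Y"
        "proj_point (?M *v s') = proj_point (?M *v s + t *s ?p)"
      by (simp_all add: frame_map_proj_point)
    have "?M *v s' \<noteq> 0" "?M *v s + t *s ?p \<noteq> 0"
      using bij_frameD(2)[OF bijA, of s' 0] bij_frameD(2)[OF bijA, of s t] s' that by auto
    with s' obtain c where c: "c \<noteq> 0" "?M *v s + t *s ?p = c *s (?M *v s')"
      using proj_point_eq_iff by metis
    then have "?M *v s + t *s ?p = ?M *v (c *s s') + 0 *s ?p"
      by (simp add: vector_scalar_commute)
    then have "s = c *s s'" "t = 0"
      using bij_frameD(1)[OF bijA] by blast+
    then show "t = 0 \<and> s \<noteq> 0 \<and> proj_point s \<in> Y"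
      using s' c proj_point_eq_iff[of s' s] that by auto
  next
    assume "t = 0 \<and> s \<noteq> 0 \<and> proj_point s \<in> Y"
    then show "proj_point (?M *v s + t *s ?p) \<in> C"
      by (auto simp: C_def frame_map_proj_point[symmetric])
  qed
  define W where "W = {s. s \<noteq> 0 \<and> proj_point (?M *v ac_vec s) \<in> C \<inter> S}"
  \<comment> \<open>Over the intersection lie the multiples of \<open>p\<close> and, for each
    \<open>s\<close> in \<open>W\<close>, the vectors with arbitrary \<open>t\<close>; hence the
    count \<open>(?Q - 1) + card W * ?Q\<close> below.\<close>
  have inX: "proj_point (ac_vec (M *v s + t *s p)) \<in> S \<inter> V \<longleftrightarrow> s = 0 \<or> s \<in> W"
    if "s \<noteq> 0 \<or> t \<noteq> 0" for s t
  proof (cases "s = 0")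
    case True
    then have "proj_point (ac_vec (M *v s + t *s p)) = proj_point ?p"
      using that by (subst proj_point_eq_iff)
        (auto simp: ac_vec_scale bij_frameD(2)[OF bijK, of 0 1, simplified] vec.scale_scale intro!: exI[of _ "to_ac (1 / t)"])
    moreover have "proj_point (ac_vec (M *v s + t *s p)) \<in> V"
      unfolding ac using cone[of "ac_vec s" "to_ac t"] that True Y by simp
    ultimately show ?thesis using pS True by simp
  next
    case False
    have "?M *v ac_vec s \<noteq> a *s ?p" for a
    proof
      assume "?M *v ac_vec s = a *s ?p"
      then have "?M *v ac_vec s + 0 *s ?p = ?M *v 0 + a *s ?p" by simp
      then show False unfolding bij_frameD(1)[OF bijA] using False by simp
    qed
    from S[OF this, of "to_ac t"] show ?thesis
      unfolding ac using cone[of "ac_vec s" "to_ac t"] inC[of "ac_vec s" 0] False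
      by (auto simp: W_def)
  qed
  define \<Theta> where "\<Theta> = (\<lambda>(s, t). M *v s + t *s p)"
  have card_\<Theta>: "card {v. \<Phi> v} = card {z. \<Phi> (\<Theta> z)}" for \<Phi>
  proof (rule bij_betw_same_card[symmetric])
    show "bij_betw \<Theta> {z. \<Phi> (\<Theta> z)} {v. \<Phi> v}"
      using bijK unfolding \<Theta>_def[symmetric] by (auto simp: bij_betw_def inj_on_def surj_def)
  qed
  have nz: "\<Theta> (s, t) \<noteq> 0 \<longleftrightarrow> s \<noteq> 0 \<or> t \<noteq> 0" for s t
    unfolding \<Theta>_def using bij_frameD(2)[OF bijK, of s t] by simp
  have "\<Theta> (s, t) \<noteq> 0 \<and> proj_point (ac_vec (\<Theta> (s, t))) \<in> S \<inter> V \<longleftrightarrow>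
      (s, t) \<in> {0} \<times> (UNIV - {0}) \<union> W \<times> UNIV" for s t
    using inX[of s t] unfolding nz by (auto simp: \<Theta>_def W_def)
  then have "{z. \<Theta> z \<noteq> 0 \<and> proj_point (ac_vec (\<Theta> z)) \<in> S \<inter> V} = {0} \<times> (UNIV - {0}) \<union> W \<times> UNIV"
    by (intro Set.set_eqI) (simp only: mem_Collect_eq split_paired_all)
  then have "card {v. v \<noteq> 0 \<and> proj_point (ac_vec v) \<in> S \<inter> V} =
      card ({0 :: 'k ^ 3} \<times> (UNIV - {0 :: 'k}) \<union> W \<times> UNIV)"
    by (simp only: card_\<Theta>)
  also have "\<dots> = (?Q - 1) + card W * ?Q"
    by (subst card_Un_disjoint) (auto simp: W_def card_cartesian_product)
  finally have "(?Q - 1) * card (rational_points (S \<inter> V)) = (?Q - 1) + card W * ?Q"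
    by (simp only: card_vectors_over_points)
  moreover have "card W = (?Q - 1) * card (rational_points (C \<inter> S))"
  proof -
    have "\<Theta> (s, t) \<noteq> 0 \<and> proj_point (ac_vec (\<Theta> (s, t))) \<in> C \<inter> S \<longleftrightarrow> (s, t) \<in> W \<times> {0}" for s t
      using inC[of "ac_vec s" "to_ac t"] unfolding nz unfolding \<Theta>_def prod.case ac
      by (cases "t = 0") (auto simp: W_def)
    then have "{z. \<Theta> z \<noteq> 0 \<and> proj_point (ac_vec (\<Theta> z)) \<in> C \<inter> S} = W \<times> {0}"
      by (intro Set.set_eqI) (simp only: mem_Collect_eq split_paired_all)
    then have "card {v. v \<noteq> 0 \<and> proj_point (ac_vec v) \<in> C \<inter> S} = card (W \<times> {0 :: 'k})"
      by (simp only: card_\<Theta>)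
    then show ?thesis
      unfolding card_vectors_over_points card_cartesian_product by simp
  qed
  ultimately have "(?Q - 1) * card (rational_points (S \<inter> V)) =
      (?Q - 1) * (1 + ?Q * card (rational_points (C \<inter> S)))"
    by (simp add: algebra_simps)
  moreover have "card {0::'k, 1} \<le> ?Q"
    by (intro card_mono) auto
  then have "?Q - 1 > 0" by simp
  ultimately show ?thesis
    unfolding C_def V_def by (simp only: nat_mult_eq_cancel1)
qed

section \<open>Hermitian forms\<close>

text \<open>Multiplication by a nonzero \<open>x\<close> permutes the nonzero elements; comparing
  their products gives \<open>x ^ (CARD('a) - 1) = 1\<close>.\<close>

lemma power_card_eq_same:
  fixes x :: "'a::{field,finite}"
  shows "x ^ CARD('a) = x"
proof (cases "x = 0")
  case False
  let ?K = "UNIV - {0 :: 'a}"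
  have "bij_betw ((*) x) ?K ?K"
    by (rule bij_betw_byWitness[of _ "\<lambda>y. y / x"]) (use False in auto)
  then have "\<Prod>?K = (\<Prod>y\<in>?K. x * y)"
    by (rule prod.reindex_bij_betw[symmetric])
  also have "\<dots> = x ^ (CARD('a) - 1) * \<Prod>?K"
    by (simp add: prod.distrib card_Diff_singleton)
  finally have "x ^ (CARD('a) - 1) = 1"
    by simp
  moreover have "CARD('a) = Suc (CARD('a) - 1)"
    by (simp add: finite_UNIV_card_ge_0)
  ultimately show ?thesis
    by (metis mult.right_neutral power_Suc)
qed simp

section \<open>The field with \<open>q\<^sup>2\<close> elements and its involution
  \<open>x ^ q\<close>\<close>

locale hermitian_field =
  fixes q :: nat and ty :: "'k::{field,finite} itself"
  assumes primepow_q: "primepow q" and card_k: "CARD('k) = q\<^sup>2"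
begin

lemma q_ge_2: "q \<ge> 2"
  using primepow_gt_Suc_0[OF primepow_q] by simp

text \<open>The characteristic is a prime dividing the number of elements, a power of the prime
  under \<open>q\<close>; so \<open>q\<close> is a power of the characteristic.\<close>

lemma add_power_q: "(x + y) ^ q = x ^ q + (y :: 'k) ^ q"
proof -
  obtain p n where p: "Factorial_Ring.prime p" "q = p ^ n"
    using primepow_q by (auto simp: primepow_def)
  have "CHAR('k) > 0"
    by (rule finite_imp_CHAR_pos) simp
  then have prime: "Factorial_Ring.prime CHAR('k)"
    by (rule prime_CHAR_semidom)
  have "CHAR('k) dvd p ^ (n * 2)"
    using CHAR_dvd_CARD[where ?'a = 'k] by (simp add: card_k p(2) power_mult)
  then have "CHAR('k) = p"
    using prime p(1) by (metis prime_dvd_power primes_dvd_imp_eq)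
  then show ?thesis
    using freshmans_dream'[OF prime, of q n] p(2) by simp
qed

lemma sum_power_q: "(\<Sum>i\<in>A. f i) ^ q = (\<Sum>i\<in>A. (f i :: 'k) ^ q)"
  using q_ge_2 by (induction A rule: infinite_finite_induct) (auto simp: add_power_q)

lemma power_q_power_q: "((x :: 'k) ^ q) ^ q = x"
  using power_card_eq_same[of x] by (simp add: card_k power2_eq_square power_mult)

end

text \<open>The sesquilinear form behind the Hermitian equation, whose isotropic vectors form the
  variety. The field is arbitrary so that it serves \<open>'k\<close> as well as the
  closure.\<close>

definition herm_form :: "nat \<Rightarrow> 'a::field ^ 'n ^ 'n::finite \<Rightarrow> 'a ^ 'n \<Rightarrow> 'a ^ 'n \<Rightarrow> 'a" where
  "herm_form q H v w = (\<Sum>i\<in>UNIV. \<Sum>j\<in>UNIV. H $ i $ j * v $ i * (w $ j) ^ q)"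

lemma herm_form_add_left: "herm_form q H (v + v') w = herm_form q H v w + herm_form q H v' w"
  by (simp add: herm_form_def algebra_simps sum.distrib)

lemma herm_form_scale_left: "herm_form q H (c *s v) w = c * herm_form q H v w"
  by (simp add: herm_form_def sum_distrib_left algebra_simps)

lemma herm_form_scale_right: "herm_form q H v (c *s w) = c ^ q * herm_form q H v w"
  by (simp add: herm_form_def sum_distrib_left power_mult_distrib algebra_simps)

lemma to_ac_herm_form:
  "to_ac (herm_form q H v w) = herm_form q (map_matrix to_ac H) (ac_vec v) (ac_vec w)"
  by (simp add: herm_form_def to_ac_sum)

text \<open>Testing with unit vectors shows that the row vector \<open>v\<close> is annihilated by
  the invertible matrix \<open>H\<close>. Here \<open>q > 0\<close> gives
  \<open>0 ^ q = 0\<close>.\<close>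

lemma herm_form_nondegenerate:
  fixes H :: "'a::field ^ 'n ^ 'n"
  assumes "rank H = CARD('n)" "q > 0" "\<And>w. herm_form q H v w = 0"
  shows "v = 0"
proof -
  have "invertible H"
    using full_column_rank_injective[OF assms(1)]
    by (simp add: invertible_left_inverse matrix_left_invertible_injective)
  then obtain B where B: "H ** B = mat 1"
    by (auto simp: invertible_def)
  have "(axis j 1 $ i :: 'a) ^ q = (if i = j then 1 else 0)" for i j :: 'n
    using assms(2) by (simp add: axis_def power_0_left)
  then have "(v v* H) $ j = herm_form q H v (axis j 1)" for j
    by (simp add: herm_form_def vector_matrix_mult_def mult_delta_left mult_delta_right mult.commute)
  then have "v v* H = 0"
    using assms(3) by (simp add: vec_eq_iff)
  then have "v v* (H ** B) = 0"
    by (metis vector_matrix_mul_assoc vector_matrix_mult_0)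
  then show ?thesis
    by (simp add: B)
qed

context hermitian_field
begin

lemma herm_form_add_right:
  "herm_form q H v (w + w') = herm_form q H v w + herm_form q H v (w' :: 'k ^ 'n::finite)"
  by (simp add: herm_form_def add_power_q algebra_simps sum.distrib)

lemma herm_form_swap:
  fixes H :: "'k ^ 'n ^ 'n::finite"
  assumes "hermitian_matrix q H"
  shows "herm_form q H w v = herm_form q H v w ^ q"
proof -
  have "herm_form q H v w ^ q = (\<Sum>i\<in>UNIV. \<Sum>j\<in>UNIV. (H $ i $ j) ^ q * (v $ i) ^ q * w $ j)"
    by (simp add: herm_form_def sum_power_q power_mult_distrib power_q_power_q)
  also have "\<dots> = (\<Sum>i\<in>UNIV. \<Sum>j\<in>UNIV. H $ j $ i * w $ j * (v $ i) ^ q)"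
  proof -
    have "(H $ i $ j) ^ q = H $ j $ i" for i j
      using assms unfolding hermitian_matrix_def by metis
    then show ?thesis by (simp add: mult_ac)
  qed
  also have "\<dots> = herm_form q H w v"
    unfolding herm_form_def by (rule sum.swap)
  finally show ?thesis by simp
qed

text \<open>The basis consists of \<open>u\<close>, the isotropic \<open>v0\<close> and
  \<open>w\<close>, with \<open>v0\<close> orthogonal to \<open>u\<close> and paired to 1 with
  \<open>w\<close>. Then \<open>v0\<close> becomes \<open>(0, 1, 0)\<close>, and on the line
  \<open>z = 0\<close> only \<open>a * x ^ (q + 1)\<close> survives, so it is the only point
  there.\<close>

lemma ex_hermitian_normal_form:
  fixes H :: "'k ^ 3 ^ 3"
  assumes H: "hermitian_matrix q H" "rank H = 3"
    and v0: "v0 \<noteq> 0" "herm_form q H v0 v0 = 0"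
  shows "\<exists>(B :: 'k ^ 3 ^ 3) a b b' c. inj ((*v) B) \<and> a \<noteq> 0 \<and>
    (\<forall>x y z. herm_form q H (B *v vector [x, y, z]) (B *v vector [x, y, z]) =
       y ^ q * z + y * z ^ q + a * x ^ (q + 1) + b * x ^ q * z + b' * x * z ^ q + c * z ^ (q + 1))"
proof -
  let ?h = "herm_form q H"
  note lin = herm_form_add_left herm_form_add_right herm_form_scale_left herm_form_scale_right
  have nondeg: "v = 0" if "\<And>w. ?h v w = 0" for v
    using herm_form_nondegenerate[of H q v] H that q_ge_2 by simp
  obtain w1 where w1: "?h v0 w1 \<noteq> 0"
    using nondeg v0(1) by blast
  then have w1': "?h w1 v0 \<noteq> 0"
    using herm_form_swap[OF H(1), of v0 w1] by (metis power_0_left q_ge_2 not_numeral_le_zero)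
  define w where "w = (1 / ?h w1 v0) *s w1"
  have wv0: "?h w v0 = 1"
    using w1' by (simp add: w_def lin)
  then have v0w: "?h v0 w = 1"
    using herm_form_swap[OF H(1), of v0 w] by simp
  have "vec.dim (vec.span {v0, w}) \<le> card {v0, w}"
    by (rule vec.dim_le_card) auto
  also have "\<dots> < CARD(3)"
    by (simp add: card_insert_if)
  finally have "vec.span {v0, w} \<noteq> UNIV"
    by (metis vec_dim_card less_irrefl)
  then obtain e where e: "e \<notin> vec.span {v0, w}" by blast
  \<comment> \<open>Since \<open>w\<close> pairs to 1 with \<open>v0\<close>, this correction makes
    \<open>u\<close> orthogonal to \<open>v0\<close> and keeps it outside the span of
    \<open>v0\<close> and \<open>w\<close>.\<close>
  define k u where "k = - ?h e v0" and "u = e + k *s w"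
  have uv0: "?h u v0 = 0"
    unfolding u_def by (simp only: lin wv0) (simp add: k_def)
  then have v0u: "?h v0 u = 0"
    using herm_form_swap[OF H(1), of v0 u] q_ge_2 by (simp add: power_0_left)
  have u_span: "u \<notin> vec.span {v0, w}"
  proof
    assume "u \<in> vec.span {v0, w}"
    then have "u + (- k) *s w \<in> vec.span {v0, w}"
      by (rule vec.span_add) (simp add: vec.span_base vec.span_scale vec.span_neg)
    moreover have "u + (- k) *s w = e"
      by (simp add: u_def vec_eq_iff)
    ultimately show False using e by simp
  qed
  define B :: "'k ^ 3 ^ 3" where "B = (\<chi> i. vector [u $ i, v0 $ i, w $ i])"
  have B: "B *v vector [x, y, z] = x *s u + y *s v0 + z *s w" for x y z
    by (simp add: B_def vec_eq_iff matrix_vector_mult_def sum_3 mult.commute)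
  have "s = 0" if "B *v s = 0" for s
  proof -
    define x y z where "x = s $ 1" and "y = s $ 2" and "z = s $ 3"
    have eq: "x *s u + (y *s v0 + z *s w) = 0"
      using that B[of x y z] by (simp add: x_def y_def z_def vector3_eta add.assoc)
    have "x = 0"
    proof (rule ccontr)
      assume x: "x \<noteq> 0"
      have "x *s u = - (y *s v0 + z *s w)"
        using eq by (simp only: eq_neg_iff_add_eq_0)
      also have "\<dots> \<in> vec.span {v0, w}"
        by (intro vec.span_neg vec.span_add vec.span_scale) (simp_all add: vec.span_base)
      finally have "(1 / x) *s (x *s u) \<in> vec.span {v0, w}"
        by (rule vec.span_scale)
      then show False using u_span x by (simp add: vec.scale_scale)
    qed
    then have eq': "y *s v0 + z *s w = 0" using eq by simp
    have "z = ?h (y *s v0 + z *s w) v0"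
      by (simp add: lin v0 wv0)
    also have "\<dots> = 0"
      unfolding eq' by (simp add: herm_form_def)
    finally have "z = 0" .
    moreover from this eq' v0(1) have "y = 0" by simp
    ultimately show "s = 0"
      using \<open>x = 0\<close> by (simp add: vec_eq_iff forall_3 x_def y_def z_def)
  qed
  then have "inj ((*v) B)"
    by (simp add: vec.inj_iff_eq_0)
  moreover have "?h u u \<noteq> 0"
  proof
    assume uu: "?h u u = 0"
    \<comment> \<open>If \<open>u\<close> were isotropic, \<open>u + k' *s v0\<close> would be
      orthogonal to the whole basis, hence zero, and \<open>u\<close> would be a multiple of
      \<open>v0\<close>.\<close>
    define k' where "k' = - ?h u w"
    have "?h (u + k' *s v0) (B *v vector [x, y, z]) = 0" for x y z
      unfolding B by (simp only: lin uu uv0 v0u v0w v0) (simp add: k'_def)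
    moreover have "\<exists>x y z. t = B *v vector [x, y, z]" for t
    proof -
      have "surj ((*v) B)"
        using \<open>inj ((*v) B)\<close> matrix_left_invertible_injective matrix_right_invertible_surjective
          matrix_left_right_inverse by metis
      then obtain s where "t = B *v s" by (auto simp: surj_def)
      then have "t = B *v vector [s $ 1, s $ 2, s $ 3]"
        by (simp add: vector3_eta)
      then show ?thesis by blast
    qed
    ultimately have "u + k' *s v0 = 0"
      by (intro nondeg) metis
    then have "u = (- k') *s v0" by (simp add: vec_eq_iff eq_neg_iff_add_eq_0)
    then have "u \<in> vec.span {v0, w}"
      by (metis insertI1 vec.span_base vec.span_scale)
    then show False using u_span by simp
  qed
  moreover have "?h (B *v vector [x, y, z]) (B *v vector [x, y, z]) =
      y ^ q * z + y * z ^ q + ?h u u * x ^ (q + 1) + ?h w u * x ^ q * z + ?h u w * x * z ^ q + ?h w w * z ^ (q + 1)"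
    for x y z
    unfolding B by (simp add: lin uv0 v0u v0w wv0 v0 algebra_simps)
  ultimately show ?thesis by blast
qed

end

section \<open>The intersection of a Hermitian cone with a surface\<close>

lemma rank_eq_CARD_iff_inj:
  fixes M :: "'a::field ^ 'n ^ 'm"
  shows "rank M = CARD('n) \<longleftrightarrow> inj ((*v) M)"
proof
  assume "inj ((*v) M)"
  then have "vec.span (rows M) = UNIV"
    using matrix_left_invertible_span_rows_gen matrix_left_invertible_injective by blast
  then show "rank M = CARD('n)"
    unfolding row_rank_def_gen by (metis vec.dim_span vec_dim_card)
qed (rule full_column_rank_injective)

lemma mvpoly_eval_scale:
  fixes F :: "('k::field, 'n::finite) mvpoly"
  assumes "homogeneous d F"
  shows "mvpoly_eval F (c *s v) = c ^ d * mvpoly_eval F v"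
  unfolding mvpoly_eval_def sum_distrib_left
proof (intro sum.cong refl)
  fix m assume "m \<in> Poly_Mapping.keys F"
  then have d: "(\<Sum>i\<in>UNIV. Poly_Mapping.lookup m i) = d"
    using assms by (simp add: homogeneous_def)
  have "monom_eval m (c *s v) = c ^ d * monom_eval m v"
    by (simp add: power_mult_distrib prod.distrib power_sum flip: d)
  then show "to_ac (Poly_Mapping.lookup F m) * monom_eval m (c *s v) =
      c ^ d * (to_ac (Poly_Mapping.lookup F m) * monom_eval m v)"
    by (simp only: mult_ac)
qed

lemma proj_point_in_zero_locus_iff:
  assumes "homogeneous d F" "v \<noteq> 0"
  shows "proj_point v \<in> zero_locus F \<longleftrightarrow> mvpoly_eval F v = 0"
  unfolding zero_locus_def
  by (rule proj_point_in_iff) (simp_all add: mvpoly_eval_scale[OF assms(1)] assms(2))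

lemma zero_locus_subset: "zero_locus F \<subseteq> proj_space"
  by (auto simp: zero_locus_def proj_space_def)

lemma hermitian_variety_subset: "hermitian_variety q H \<subseteq> proj_space"
  by (auto simp: hermitian_variety_def proj_space_def)

lemma proj_point_in_hermitian_variety_iff:
  assumes "v \<noteq> 0"
  shows "proj_point v \<in> hermitian_variety q H \<longleftrightarrow> herm_form q (map_matrix to_ac H) v v = 0"
proof -
  have "hermitian_variety q H = {proj_point w | w. w \<noteq> 0 \<and> herm_form q (map_matrix to_ac H) w w = 0}"
    by (simp add: hermitian_variety_def herm_form_def)
  then show ?thesis
    by (simp only:) (rule proj_point_in_iff, simp_all add: assms herm_form_scale_left herm_form_scale_right)
qed

text \<open>Adding a multiple of \<open>p\<close> changes only \<open>t\<close>, while membership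
  depends on \<open>s\<close>, which is nonzero off the line of \<open>p\<close>.\<close>

lemma cone_translate_iff:
  fixes M :: "'k::field ^ 3 ^ 4"
  assumes bij: "bij (\<lambda>(s, t). map_matrix to_ac M *v s + t *s p)" and Y: "Y \<subseteq> proj_space"
    and v: "\<And>a. v \<noteq> a *s p"
  shows "proj_point (v + t *s p) \<in> proj_cone (proj_point p) (frame_map M ` Y) \<longleftrightarrow>
    proj_point v \<in> proj_cone (proj_point p) (frame_map M ` Y)"
proof -
  obtain s t' where st: "v = map_matrix to_ac M *v s + t' *s p"
    using bij_frameD(3)[OF bij] by blast
  then have "s \<noteq> 0" using v[of t'] by auto
  have eq: "v + t *s p = map_matrix to_ac M *v s + (t' + t) *s p"
    unfolding st by (simp add: vec.scale_left_distrib)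
  show ?thesis
    unfolding eq unfolding st proj_point_in_cone_iff[OF bij Y disjI1[OF \<open>s \<noteq> 0\<close>]] ..
qed

text \<open>\<open>G\<close> is the restriction of \<open>F\<close> to the plane of
  \<open>M\<close>. By \<open>indep\<close> the vanishing of \<open>F\<close> depends on
  \<open>s\<close> alone; \<open>d \<ge> 1\<close> puts the vertex on the surface, and the zero
  \<open>s0\<close> makes the base nonempty, so the vertex is on the cone as well.\<close>

lemma zero_locus_eq_cone:
  fixes F :: "('k::field, 4) mvpoly" and M :: "'k ^ 3 ^ 4"
  assumes F: "homogeneous d F" "F \<noteq> 0" and d: "d \<ge> 1"
    and bij: "bij (\<lambda>(s, t). map_matrix to_ac M *v s + t *s p)"
    and indep: "\<And>s t. mvpoly_eval F (map_matrix to_ac M *v s + t *s p) = mvpoly_eval F (map_matrix to_ac M *v s)"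
    and ne: "s0 \<noteq> 0" "mvpoly_eval F (map_matrix to_ac M *v s0) = 0"
  shows "\<exists>G :: ('k, 3) mvpoly. G \<noteq> 0 \<and> homogeneous d G \<and> zero_locus G \<noteq> {} \<and>
    zero_locus F = proj_cone (proj_point p) (frame_map M ` zero_locus G)"
proof -
  obtain G :: "('k, 3) mvpoly" where G: "homogeneous d G"
      "\<And>s. mvpoly_eval G s = mvpoly_eval F (map_matrix to_ac M *v s)"
    using ex_mvpoly_linear_substitution[OF F(1), of M] by blast
  have FG: "mvpoly_eval F (map_matrix to_ac M *v s + t *s p) = mvpoly_eval G s" for s t
    by (simp only: indep G(2))
  have G_ne: "zero_locus G \<noteq> {}"
    using ne proj_point_in_zero_locus_iff[OF G(1) ne(1)] G(2) by auto
  have "G \<noteq> 0"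
  proof
    assume "G = 0"
    moreover obtain v where "mvpoly_eval F v \<noteq> 0"
      using ex_mvpoly_eval_nonzero[OF F(2)] by blast
    ultimately show False
      using bij_frameD(3)[OF bij, of v] FG by auto
  qed
  have G0: "mvpoly_eval G 0 = 0"
    using mvpoly_eval_scale[OF G(1), of 0 0] d by (simp add: power_0_left)
  have iff: "proj_point v \<in> zero_locus F \<longleftrightarrow> proj_point v \<in> proj_cone (proj_point p) (frame_map M ` zero_locus G)"
    if "v \<noteq> 0" for v
  proof -
    obtain s t where v: "v = map_matrix to_ac M *v s + t *s p"
      using bij_frameD(3)[OF bij] by blast
    then have st: "s \<noteq> 0 \<or> t \<noteq> 0"
      using that by auto
    have "proj_point v \<in> zero_locus F \<longleftrightarrow> mvpoly_eval G s = 0"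
      using proj_point_in_zero_locus_iff[OF F(1) that] unfolding v FG .
    also have "\<dots> \<longleftrightarrow> (if s = 0 then zero_locus G \<noteq> {} else proj_point s \<in> zero_locus G)"
      using G0 G_ne proj_point_in_zero_locus_iff[OF G(1)] by simp
    also have "\<dots> \<longleftrightarrow> proj_point v \<in> proj_cone (proj_point p) (frame_map M ` zero_locus G)"
      unfolding v using proj_point_in_cone_iff[OF bij zero_locus_subset st] by simp
    finally show ?thesis .
  qed
  have "zero_locus F = proj_cone (proj_point p) (frame_map M ` zero_locus G)"
  proof (rule Set.set_eqI)
    fix R
    show "R \<in> zero_locus F \<longleftrightarrow> R \<in> proj_cone (proj_point p) (frame_map M ` zero_locus G)"
    proof (cases "R \<in> proj_space")
      case True
      then show ?thesis using iff by (auto simp: proj_space_def)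
    next
      case False
      then show ?thesis
        using zero_locus_subset[of F] by (auto simp: proj_cone_def line_through_def)
    qed
  qed
  then show ?thesis
    using \<open>G \<noteq> 0\<close> G(1) G_ne by blast
qed

lemma monom_eval_vec4:
  "monom_eval m (vec4 x y z t) = x ^ Poly_Mapping.lookup m 1 * y ^ Poly_Mapping.lookup m 2 *
     z ^ Poly_Mapping.lookup m 3 * t ^ Poly_Mapping.lookup m 4"
  unfolding UNIV_4 by (simp add: mult.assoc)

lemma ac_vec_vec4: "ac_vec (vec4 x y z t) = vec4 (to_ac x) (to_ac y) (to_ac z) (to_ac t)"
  by (simp add: vec_eq_iff forall_4)

context hermitian_field
begin

lemma card_k_gt_1: "CARD('k) > 1"
  unfolding card_k using q_ge_2 by (intro one_less_power) auto

text \<open>At rational vectors the value of \<open>F\<close> is the image of a sum in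
  \<open>'k\<close>, so the count for cones applies with the exponent vectors themselves as
  indices.\<close>

lemma card_hermitian_cone_inter_non_cone_less:
  fixes F :: "('k, 4) mvpoly" and a b b' c :: 'k
  assumes F: "homogeneous d F" and d: "d \<le> q" and a: "a \<noteq> 0"
    and m0: "m0 \<in> Poly_Mapping.keys F" "Poly_Mapping.lookup m0 4 \<noteq> 0"
  shows "card {(x, y, z, t). (x, y, z) \<noteq> (0, 0, 0) \<and>
      y ^ q * z + y * z ^ q + a * x ^ (q + 1) + b * x ^ q * z + b' * x * z ^ q + c * z ^ (q + 1) = 0 \<and>
      mvpoly_eval F (ac_vec (vec4 x y z t)) = 0} < (CARD('k) - 1) * (q\<^sup>2 * d * (q + 1))"
proof -
  let ?I = "Poly_Mapping.keys F" and ?l = "\<lambda>i m. Poly_Mapping.lookup m (i :: 4)"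
  define e where "e = Max (?l 4 ` ?I)"
  have e_le: "?l 4 m \<le> e" if "m \<in> ?I" for m
    unfolding e_def using that by (intro Max_ge) auto
  have "e \<in> ?l 4 ` ?I"
    unfolding e_def using m0 by (intro Max_in) auto
  then have e_eq: "\<exists>m\<in>?I. ?l 4 m = e" by auto
  have e_pos: "e \<ge> 1"
    using e_le[OF m0(1)] m0(2) by linarith
  have deg: "?l 1 m + ?l 2 m + ?l 3 m + ?l 4 m = d" if "m \<in> ?I" for m
    using F that by (auto simp: homogeneous_def sum_4)
  then have "e \<le> d" using e_eq by fastforce
  have inj: "inj_on (\<lambda>m. (?l 1 m, ?l 2 m, ?l 3 m, ?l 4 m)) ?I"
    by (auto simp: inj_on_def poly_mapping_eq_iff fun_eq_iff forall_4)
  have eval: "mvpoly_eval F (ac_vec (vec4 x y z t)) =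
      to_ac (\<Sum>m\<in>?I. Poly_Mapping.lookup F m * (x ^ ?l 1 m * y ^ ?l 2 m * z ^ ?l 3 m * t ^ ?l 4 m))"
    for x y z t
    unfolding mvpoly_eval_def ac_vec_vec4 monom_eval_vec4 by (simp add: to_ac_sum)
  have "card {(x, y, z, t). (x, y, z) \<noteq> (0, 0, 0) \<and>
      y ^ q * z + y * z ^ q + a * x ^ (q + 1) + b * x ^ q * z + b' * x * z ^ q + c * z ^ (q + 1) = 0 \<and>
      mvpoly_eval F (ac_vec (vec4 x y z t)) = 0}
      \<le> (CARD('k) - 1) * ((q ^ 3 + 1) * e + (d - e) * (q + 1) * (q\<^sup>2 - e))"
    unfolding eval to_ac_eq_0_iff
    by (rule card_hermitian_cone_inter_le[OF q_ge_2 card_k a _ _ deg d inj e_le e_eq e_pos])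
      (simp_all add: in_keys_iff)
  also have "\<dots> < (CARD('k) - 1) * (q\<^sup>2 * d * (q + 1))"
    using cone_bound_less[OF q_ge_2 e_pos \<open>e \<le> d\<close> d] card_k_gt_1
    by (intro mult_strict_left_mono) auto
  finally show ?thesis .
qed

end

text \<open>Keeps the vertex off the plane when the frame is changed inside it; \<open>B\<close>
  stays injective over the closure because it is invertible.\<close>

lemma plane_of_mult_subset:
  fixes M :: "'k::field ^ 3 ^ 4" and B :: "'k ^ 3 ^ 3"
  assumes "inj ((*v) B)"
  shows "plane_of (M ** B) \<subseteq> plane_of M"
proof
  fix R assume "R \<in> plane_of (M ** B)"
  then obtain s where s: "s \<noteq> 0" "R = frame_map (M ** B) (proj_point s)"
    by (auto simp: plane_of_def proj_space_def)
  have "invertible B"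
    using assms by (simp add: invertible_left_inverse matrix_left_invertible_injective)
  then have "inj ((*v) (map_matrix to_ac B))"
    using invertible_map_matrix_to_ac
    by (metis invertible_left_inverse matrix_left_invertible_injective)
  then have "map_matrix to_ac B *v s \<noteq> 0"
    using s(1) unfolding vec.inj_iff_eq_0 by blast
  moreover have "R = frame_map M (proj_point (map_matrix to_ac B *v s))"
    unfolding s(2) frame_map_proj_point by (simp add: map_matrix_to_ac_mult matrix_vector_mul_assoc)
  ultimately show "R \<in> plane_of M"
    unfolding plane_of_def by (simp add: image_eqI)
qed

lemma inj_matrix_mult:
  fixes M :: "'a::field ^ 'n ^ 'm" and B :: "'a ^ 'l ^ 'n"
  assumes "inj ((*v) M)" "inj ((*v) B)"
  shows "inj ((*v) (M ** B))"
  using inj_compose[OF assms] by (simp add: comp_def matrix_vector_mul_assoc)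

lemma bij_frame_ac:
  fixes M :: "'k::field ^ 3 ^ 4"
  assumes "invertible (adjoin_column M p)"
  shows "bij (\<lambda>(s, t). map_matrix to_ac M *v s + t *s ac_vec p)"
  using bij_adjoin_column[of "map_matrix to_ac M" "ac_vec p"] invertible_map_matrix_to_ac[OF assms]
  by (simp add: map_matrix_adjoin_column)

context hermitian_field
begin

section \<open>A fixed Hermitian cone \<open>S\<close> with vertex \<open>[p]\<close>\<close>

context
  fixes H :: "'k ^ 3 ^ 3" and M\<^sub>1 :: "'k ^ 3 ^ 4" and p :: "'k ^ 4" and S :: "('k, 4) ppoint set"
  assumes H: "hermitian_matrix q H" "rank H = 3"
    and M1: "rank M\<^sub>1 = 3" "proj_point (ac_vec p) \<notin> plane_of M\<^sub>1" and p: "p \<noteq> 0"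
    and S: "S = proj_cone (proj_point (ac_vec p)) (frame_map M\<^sub>1 ` hermitian_variety q H)"
begin

lemma inj_M1: "inj ((*v) M\<^sub>1)"
  using M1(1) rank_eq_CARD_iff_inj[of M\<^sub>1] by simp

lemma inv_M1: "invertible (adjoin_column M\<^sub>1 p)"
  by (rule invertible_adjoin_column[OF inj_M1 p M1(2)])

lemma S_translate:
  "(\<And>a. v \<noteq> a *s ac_vec p) \<Longrightarrow> proj_point (v + t *s ac_vec p) \<in> S \<longleftrightarrow> proj_point v \<in> S"
  unfolding S by (rule cone_translate_iff[OF bij_frame_ac[OF inv_M1] hermitian_variety_subset])

lemma vertex_in_S:
  assumes "S \<noteq> {}"
  shows "proj_point (ac_vec p) \<in> S"
  using proj_point_in_cone_iff[OF bij_frame_ac[OF inv_M1] hermitian_variety_subset[of q H], of 0 1] assms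
  unfolding S by (auto simp: proj_cone_def)

lemma S_iff:
  assumes "s \<noteq> 0"
  shows "proj_point (ac_vec (M\<^sub>1 *v s + t *s p)) \<in> S \<longleftrightarrow> herm_form q H s s = 0"
  using proj_point_in_cone_iff[OF bij_frame_ac[OF inv_M1] hermitian_variety_subset[of q H], of "ac_vec s" "to_ac t"]
    proj_point_in_hermitian_variety_iff[of "ac_vec s" q H] assms
  by (simp add: S ac_vec_add ac_vec_scale ac_vec_matrix flip: to_ac_herm_form)

lemma card_rational_points_S_cone:
  assumes M: "rank M = 3" "proj_point (ac_vec p) \<notin> plane_of M"
    and Y: "Y \<subseteq> proj_space" "Y \<noteq> {}" and "S \<noteq> {}"
  shows "card (rational_points (S \<inter> proj_cone (proj_point (ac_vec p)) (frame_map M ` Y))) =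
    1 + q\<^sup>2 * card (rational_points (frame_map M ` Y \<inter> S))"
proof -
  have "invertible (adjoin_column M p)"
    using invertible_adjoin_column[OF _ p M(2)] M(1) rank_eq_CARD_iff_inj[of M] by simp
  then show ?thesis
    using card_rational_points_cone_inter[OF _ S_translate vertex_in_S[OF \<open>S \<noteq> {}\<close>] Y] card_k by simp
qed

text \<open>In a frame with the Hermitian form in normal form, an occurrence of the last variable
  would make the intersection too small. So the form does not change along \<open>p\<close>, and
  \<open>zero_locus_eq_cone\<close> applies.\<close>

lemma cone_of_card_eq:
  fixes F :: "('k, 4) mvpoly"
  assumes F: "F \<noteq> 0" "homogeneous d F" and d: "1 \<le> d" "d \<le> q"
    and card: "card (rational_points (S \<inter> zero_locus F)) = 1 + q\<^sup>2 * d * (q + 1)"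
  shows "\<exists>(M :: 'k ^ 3 ^ 4) G. rank M = 3 \<and> proj_point (ac_vec p) \<notin> plane_of M \<and>
    G \<noteq> 0 \<and> homogeneous d G \<and> zero_locus G \<noteq> {} \<and>
    zero_locus F = proj_cone (proj_point (ac_vec p)) (frame_map M ` zero_locus G)"
proof -
  define Vs where "Vs = {v. v \<noteq> 0 \<and> proj_point (ac_vec v) \<in> S \<inter> zero_locus F}"
  have card_Vs: "card Vs = (CARD('k) - 1) * (1 + q\<^sup>2 * d * (q + 1))"
    unfolding Vs_def card_vectors_over_points card ..
  have card_line: "card ((\<lambda>t. t *s p) ` (UNIV - {0})) \<le> CARD('k) - 1"
    by (rule order_trans[OF card_image_le]) (simp_all add: card_Diff_singleton)
  have VsD: "mvpoly_eval F (ac_vec v) = 0" if "v \<in> Vs" for v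
    using that proj_point_in_zero_locus_iff[OF F(2), of "ac_vec v"] by (simp add: Vs_def)
  \<comment> \<open>The prescribed number of points exceeds 1, so some common point differs from the
    vertex. Its component \<open>s1\<close> is the isotropic vector from which the normal form
    starts.\<close>
  obtain s1 t1 where st1: "s1 \<noteq> 0" "M\<^sub>1 *v s1 + t1 *s p \<in> Vs"
  proof (rule ccontr)
    assume none: "\<not> thesis"
    have "Vs \<subseteq> (\<lambda>t. t *s p) ` (UNIV - {0})"
    proof
      fix v assume v: "v \<in> Vs"
      obtain s t where st: "v = M\<^sub>1 *v s + t *s p"
        using bij_frameD(3)[OF bij_adjoin_column[OF inv_M1]] by blast
      then have "s = 0" using none that v by blast
      then have "v = t *s p" "t \<noteq> 0" using st v by (auto simp: Vs_def)
      then show "v \<in> (\<lambda>t. t *s p) ` (UNIV - {0})" by blast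
    qed
    then have "card Vs \<le> CARD('k) - 1"
      using card_line card_mono[of "(\<lambda>t. t *s p) ` (UNIV - {0})" Vs] by simp
    moreover have "(CARD('k) - 1) * 1 < (CARD('k) - 1) * (1 + q\<^sup>2 * d * (q + 1))"
      using card_k_gt_1 d q_ge_2 by (intro mult_strict_left_mono) auto
    ultimately show False
      unfolding card_Vs by linarith
  qed
  have v0: "herm_form q H s1 s1 = 0"
    using st1(2) S_iff[OF st1(1), of t1] by (simp add: Vs_def)
  obtain B :: "'k ^ 3 ^ 3" and a b b' c where B: "inj ((*v) B)" "a \<noteq> 0"
    and normal: "\<And>x y z. herm_form q H (B *v vector [x, y, z]) (B *v vector [x, y, z]) =
       y ^ q * z + y * z ^ q + a * x ^ (q + 1) + b * x ^ q * z + b' * x * z ^ q + c * z ^ (q + 1)"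
    using ex_hermitian_normal_form[OF H st1(1) v0] by blast
  define M where "M = M\<^sub>1 ** B"
  have inj_M: "inj ((*v) M)"
    unfolding M_def by (rule inj_matrix_mult[OF inj_M1 B(1)])
  have P_M: "proj_point (ac_vec p) \<notin> plane_of M"
    unfolding M_def using plane_of_mult_subset[OF B(1)] M1(2) by blast
  define T where "T = adjoin_column M p"
  have inv_T: "invertible T"
    unfolding T_def by (rule invertible_adjoin_column[OF inj_M p P_M])
  note bijK = bij_adjoin_column[OF inv_T[unfolded T_def]]
  note bijA = bij_frame_ac[OF inv_T[unfolded T_def]]
  obtain F' :: "('k, 4) mvpoly" where F': "homogeneous d F'"
      "\<And>x. mvpoly_eval F' x = mvpoly_eval F (map_matrix to_ac T *v x)"
    using ex_mvpoly_linear_substitution[OF F(2), of T] by blast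
  have F'_eval: "mvpoly_eval F' (vec4 x y z t) =
      mvpoly_eval F (map_matrix to_ac M *v vector [x, y, z] + t *s ac_vec p)" for x y z t
    by (simp add: F'(2) T_def map_matrix_adjoin_column adjoin_column_mult)
  have no_x4: "Poly_Mapping.lookup m 4 = 0" if m: "m \<in> Poly_Mapping.keys F'" for m
  proof (rule ccontr)
    assume m4: "Poly_Mapping.lookup m 4 \<noteq> 0"
    define Z where "Z = {(x, y, z, t). (x, y, z) \<noteq> (0, 0, 0) \<and>
      y ^ q * z + y * z ^ q + a * x ^ (q + 1) + b * x ^ q * z + b' * x * z ^ q + c * z ^ (q + 1) = 0 \<and>
      mvpoly_eval F' (ac_vec (vec4 x y z t)) = 0}"
    have card_Z: "card Z < (CARD('k) - 1) * (q\<^sup>2 * d * (q + 1))"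
      unfolding Z_def by (rule card_hermitian_cone_inter_non_cone_less[OF F'(1) d(2) B(2) m m4])
    \<comment> \<open>A vector of \<open>Vs\<close> is a multiple of \<open>p\<close> or is counted
      by \<open>Z\<close>, so \<open>Vs\<close> would have fewer elements than
      \<open>card_Vs\<close> states.\<close>
    have "Vs \<subseteq> (\<lambda>t. t *s p) ` (UNIV - {0}) \<union> (\<lambda>(x, y, z, t). T *v vec4 x y z t) ` Z"
    proof
      fix v assume v: "v \<in> Vs"
      obtain s t where st: "v = M *v s + t *s p"
        using bij_frameD(3)[OF bijK] by blast
      show "v \<in> (\<lambda>t. t *s p) ` (UNIV - {0}) \<union> (\<lambda>(x, y, z, t). T *v vec4 x y z t) ` Z"
      proof (cases "s = 0")
        case True
        then have "v = t *s p" "t \<noteq> 0" using st v by (auto simp: Vs_def)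
        then show ?thesis by blast
      next
        case False
        define x y z where "x = s $ 1" and "y = s $ 2" and "z = s $ 3"
        have s: "s = vector [x, y, z]"
          by (simp add: x_def y_def z_def vector3_eta)
        have vT: "v = T *v vec4 x y z t"
          by (simp add: T_def adjoin_column_mult st s)
        have "B *v s \<noteq> 0"
          using B(1) False unfolding vec.inj_iff_eq_0 by blast
        moreover have "v = M\<^sub>1 *v (B *v s) + t *s p"
          by (simp add: st M_def matrix_vector_mul_assoc)
        ultimately have "herm_form q H (B *v s) (B *v s) = 0"
          using v S_iff by (auto simp: Vs_def)
        moreover have "(x, y, z) \<noteq> (0, 0, 0)"
          using False by (auto simp: vec_eq_iff forall_3 x_def y_def z_def)
        moreover have "mvpoly_eval F' (ac_vec (vec4 x y z t)) = 0"
          using VsD[OF v] unfolding F'(2) vT by (simp add: ac_vec_matrix)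
        ultimately have "(x, y, z, t) \<in> Z"
          unfolding Z_def s normal by simp
        then show ?thesis
          using vT by (intro UnI2 image_eqI[of _ _ "(x, y, z, t)"]) simp_all
      qed
    qed
    then have "card Vs \<le> card ((\<lambda>t. t *s p) ` (UNIV - {0}) \<union> (\<lambda>(x, y, z, t). T *v vec4 x y z t) ` Z)"
      by (intro card_mono) auto
    also have "\<dots> \<le> card ((\<lambda>t. t *s p) ` (UNIV - {0})) + card ((\<lambda>(x, y, z, t). T *v vec4 x y z t) ` Z)"
      by (rule card_Un_le)
    also have "\<dots> \<le> (CARD('k) - 1) + card Z"
      by (intro add_mono card_line card_image_le) simp
    also have "\<dots> < (CARD('k) - 1) + (CARD('k) - 1) * (q\<^sup>2 * d * (q + 1))"
      using card_Z by simp
    finally show False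
      unfolding card_Vs by (simp add: algebra_simps)
  qed
  have F'_indep: "mvpoly_eval F' (vec4 x y z t) = mvpoly_eval F' (vec4 x y z 0)" for x y z t
    unfolding mvpoly_eval_def monom_eval_vec4 by (intro sum.cong refl) (simp add: no_x4)
  have indep: "mvpoly_eval F (map_matrix to_ac M *v s + t *s ac_vec p) = mvpoly_eval F (map_matrix to_ac M *v s)"
    for s t
    using F'_eval[of "s $ 1" "s $ 2" "s $ 3" t] F'_eval[of "s $ 1" "s $ 2" "s $ 3" 0]
      F'_indep[of "s $ 1" "s $ 2" "s $ 3" t] by (simp add: vector3_eta)
  \<comment> \<open>The common point found above, rewritten in the new frame, supplies the point of
    the base curve that \<open>zero_locus_eq_cone\<close> asks for.\<close>
  obtain s0 t0 where st0: "M\<^sub>1 *v s1 + t1 *s p = M *v s0 + t0 *s p"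
    using bij_frameD(3)[OF bijK] by blast
  have "s0 \<noteq> 0"
  proof
    assume "s0 = 0"
    then have "M\<^sub>1 *v s1 + t1 *s p = M\<^sub>1 *v 0 + t0 *s p"
      using st0 by simp
    then show False
      using st1(1) unfolding bij_frameD(1)[OF bij_adjoin_column[OF inv_M1]] by simp
  qed
  moreover have "mvpoly_eval F (map_matrix to_ac M *v ac_vec s0) = 0"
    using VsD[OF st1(2)] indep unfolding st0 by (simp add: ac_vec_add ac_vec_scale ac_vec_matrix)
  ultimately obtain G :: "('k, 3) mvpoly" where "G \<noteq> 0" "homogeneous d G" "zero_locus G \<noteq> {}"
      "zero_locus F = proj_cone (proj_point (ac_vec p)) (frame_map M ` zero_locus G)"
    using zero_locus_eq_cone[OF F(2) F(1) d(1) bijA indep, of "ac_vec s0"] by auto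
  moreover have "rank M = 3"
    using inj_M rank_eq_CARD_iff_inj[of M] by simp
  ultimately show ?thesis
    using P_M by blast
qed

end

end

theorem theorem3p9:
  fixes q d :: nat
    and P :: "('k::{field, finite}, 4) ppoint"
    and PU\<^sub>2 :: "('k, 4) ppoint set"
    and F :: "('k, 4) mvpoly"
  assumes "primepow q"
    and "CARD('k) = q\<^sup>2"
    and "rank3_hermitian_surface q P PU\<^sub>2"
    and "F \<noteq> 0" and "homogeneous d F"
    and "1 \<le> d" and "d \<le> q"
  shows "card (rational_points (PU\<^sub>2 \<inter> zero_locus F)) = 1 + q\<^sup>2 * d * (q + 1) \<longleftrightarrow>
    (\<exists>(M :: 'k ^ 3 ^ 4) C. rank M = 3 \<and> P \<notin> plane_of M \<and> plane_curve M C \<and>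
       zero_locus F = proj_cone P C \<and> card (rational_points (C \<inter> PU\<^sub>2)) = d * (q + 1))"
proof -
  interpret hermitian_field q "TYPE('k)"
    by unfold_locales fact+
  obtain p :: "'k ^ 4" where p: "p \<noteq> 0" "P = proj_point (ac_vec p)"
    using assms(3) by (auto simp: rank3_hermitian_surface_def rational_points_def ac_vec_def)
  obtain M1 :: "'k ^ 3 ^ 4" and H :: "'k ^ 3 ^ 3" where
    M1: "rank M1 = 3" "proj_point (ac_vec p) \<notin> plane_of M1" and
    H: "hermitian_matrix q H" "rank H = 3" and
    S: "PU\<^sub>2 = proj_cone (proj_point (ac_vec p)) (frame_map M1 ` hermitian_variety q H)"
    using assms(3) unfolding rank3_hermitian_surface_def nondegenerate_hermitian_curve_def p(2) by blast
  note count = card_rational_points_S_cone[OF H M1 p(1) S]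
  show ?thesis
  proof
    assume card: "card (rational_points (PU\<^sub>2 \<inter> zero_locus F)) = 1 + q\<^sup>2 * d * (q + 1)"
    obtain M :: "'k ^ 3 ^ 4" and G :: "('k, 3) mvpoly" where
      M: "rank M = 3" "proj_point (ac_vec p) \<notin> plane_of M" and
      G: "G \<noteq> 0" "homogeneous d G" "zero_locus G \<noteq> {}" and
      cone: "zero_locus F = proj_cone (proj_point (ac_vec p)) (frame_map M ` zero_locus G)"
      using cone_of_card_eq[OF H M1 p(1) S assms(4-7) card] by blast
    have "PU\<^sub>2 \<noteq> {}"
      using card by (auto simp: rational_points_def)
    from count[OF M zero_locus_subset G(3) this] have
      "q\<^sup>2 * card (rational_points (frame_map M ` zero_locus G \<inter> PU\<^sub>2)) = q\<^sup>2 * (d * (q + 1))"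
      using card by (simp add: cone algebra_simps)
    then have "card (rational_points (frame_map M ` zero_locus G \<inter> PU\<^sub>2)) = d * (q + 1)"
      using q_ge_2 by simp
    moreover have "plane_curve M (frame_map M ` zero_locus G)"
      unfolding plane_curve_def using G assms(6) by blast
    ultimately show "\<exists>(M :: 'k ^ 3 ^ 4) C. rank M = 3 \<and> P \<notin> plane_of M \<and> plane_curve M C \<and>
       zero_locus F = proj_cone P C \<and> card (rational_points (C \<inter> PU\<^sub>2)) = d * (q + 1)"
      using M cone p(2) by blast
  next
    assume "\<exists>(M :: 'k ^ 3 ^ 4) C. rank M = 3 \<and> P \<notin> plane_of M \<and> plane_curve M C \<and>
       zero_locus F = proj_cone P C \<and> card (rational_points (C \<inter> PU\<^sub>2)) = d * (q + 1)"
    then obtain M :: "'k ^ 3 ^ 4" and G :: "('k, 3) mvpoly" where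
      M: "rank M = 3" "proj_point (ac_vec p) \<notin> plane_of M" and
      cone: "zero_locus F = proj_cone (proj_point (ac_vec p)) (frame_map M ` zero_locus G)" and
      card: "card (rational_points (frame_map M ` zero_locus G \<inter> PU\<^sub>2)) = d * (q + 1)"
      unfolding plane_curve_def p(2) by blast
    \<comment> \<open>Counting on cones needs a nonempty base and a nonempty Hermitian surface; both
      follow from \<open>d * (q + 1) > 0\<close>.\<close>
    have "rational_points (frame_map M ` zero_locus G \<inter> PU\<^sub>2) \<noteq> {}"
      using card assms(6) by auto
    then have "zero_locus G \<noteq> {}" "PU\<^sub>2 \<noteq> {}"
      by (auto simp: rational_points_def)
    from count[OF M zero_locus_subset this] show
      "card (rational_points (PU\<^sub>2 \<inter> zero_locus F)) = 1 + q\<^sup>2 * d * (q + 1)"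
      by (simp add: cone card algebra_simps)
  qed
qed

end
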